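(* $\hat r_{\mathrm{edge}}(B_{m,n}^{\prec})=\Theta(m2^mn^2)$ for sufficiently large $n$ and a fixed integer $m$.
   Context: All graphs are finite, simple and undirected. An edge-ordered graph $G^{\prec}$ is a pair $(G,\prec)$ of a graph $G$ and a linear order $\prec$ on $E(G)$. $G^{\prec}$ is an edge-ordered subgraph of $H^{\prec}$ if $G$ is a subgraph of $H$ and the edge order of $G$ is a suborder of the edge order of $H$. Two edge-ordered graphs are isomorphic if there is a graph isomorphism whose induced map on edges preserves the edge orders. An edge-ordered copy of $G^{\prec}$ in $F^{\prec}$ is an edge-ordered subgraph of $F^{\prec}$ isomorphic to $G^{\prec}$. For edge-ordered graphs $G^{\prec},H^{\prec}$, the size edge-ordered Ramsey number $\hat r_{\mathrm{edge}}(G^{\prec},H^{\prec})$ is the minimum number $N$ such that there exists an edge-ordered graph $F^{\prec}$ with $N$ edges such that every red/blue coloring of the edges of $F^{\prec}$ contains a red edge-ordered copy of $G^{\prec}$ or a blue edge-ordered copy of $H^{\prec}$. Write $\hat r_{\mathrm{edge}}(G^{\prec})=\hat r_{\mathrm{edge}}(G^{\prec},G^{\prec})$. The book graph $B_{m,n}$ is obtained by taking $n$ copies of $K_{m+1}$ and identifying them along a common $K_m$ (the spine); the remaining $n$ vertices, which are pairwise non-adjacent, are the pages. Let the spine vertices be $u_1,\dots,u_m$ and the page vertices $v_1,\dots,v_n$. The edge-ordered book graph $B_{m,n}^{\prec}$ is $B_{m,n}$ with the following edge order: for spine edges $u_iu_j$ ($1\le i<j\le m$) and $u_su_t$ ($1\le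 s<t\le m$), $u_iu_j\prec u_su_t$ iff $i<s$, or $i=s$ and $j<t$; every spine edge precedes every page-spine edge; and for page-spine edges, $v_iu_j\prec v_su_t$ iff $i<s$, or $i=s$ and $j<t$ (here $1\le i,s\le n$ and $1\le j,t\le m$).
   Formalization: Proved for every fixed integer m ≥ 2, with implied constants independent of m; m = 1 is excluded because the book is then the star K_{1,n}, whose size edge-ordered Ramsey number is at most 2n−1, so the quadratic bound fails; the edgeless case m = 0 is also excluded. *)

theory Defs
  imports Complex_Main "HOL-Library.Extended_Real"
begin

text \<open>An edge is a two-element set of vertices. The third component is the strict order on the
  edges, as a set of pairs (smaller edge, larger edge).\<close>

record 'a eo_graph =
  verts :: "'a set"
  edges :: "'a set set"
  edge_less :: "('a set \<times> 'a set) set"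

definition edge_ordered_graph :: "'a eo_graph \<Rightarrow> bool" where
  "edge_ordered_graph G \<longleftrightarrow>
     finite (verts G) \<and>
     (\<forall>e \<in> edges G. e \<subseteq> verts G \<and> card e = 2) \<and>
     edge_less G \<subseteq> edges G \<times> edges G \<and>
     strict_linear_order_on (edges G) (edge_less G)"

definition eo_subgraph :: "'a eo_graph \<Rightarrow> 'a eo_graph \<Rightarrow> bool" where
  "eo_subgraph G H \<longleftrightarrow>
     edge_ordered_graph G \<and> edge_ordered_graph H \<and>
     verts G \<subseteq> verts H \<and> edges G \<subseteq> edges H \<and>
     edge_less G = edge_less H \<inter> (edges G \<times> edges G)"

definition eo_isomorphic :: "'a eo_graph \<Rightarrow> 'b eo_graph \<Rightarrow> bool" where
  "eo_isomorphic G H \<longleftrightarrow>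
     (\<exists>f. bij_betw f (verts G) (verts H) \<and>
          edges H = (\<lambda>e. f ` e) ` edges G \<and>
          (\<forall>e \<in> edges G. \<forall>e' \<in> edges G.
             (e, e') \<in> edge_less G \<longleftrightarrow> (f ` e, f ` e') \<in> edge_less H))"

definition eo_copy :: "'a eo_graph \<Rightarrow> 'b eo_graph \<Rightarrow> 'a eo_graph \<Rightarrow> bool" where
  "eo_copy C G F \<longleftrightarrow> eo_subgraph C F \<and> eo_isomorphic C G"

text \<open>A red/blue coloring of the edges of \<open>F\<close> is given by its set \<open>R\<close> of red edges.\<close>

definition eo_arrows :: "'a eo_graph \<Rightarrow> 'b eo_graph \<Rightarrow> 'c eo_graph \<Rightarrow> bool" where
  "eo_arrows F G H \<longleftrightarrow>
     (\<forall>R \<subseteq> edges F.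
        (\<exists>C. eo_copy C G F \<and> edges C \<subseteq> R) \<or>
        (\<exists>C. eo_copy C H F \<and> edges C \<subseteq> edges F - R))"

text \<open>Every finite graph is isomorphic to one with vertices in \<^typ>\<open>nat\<close>, so it suffices to let
  \<open>F\<close> range over those. The value is an extended natural number so that the definition does not
  presuppose that a suitable \<open>F\<close> exists: it is \<^term>\<open>\<infinity> :: enat\<close> if there is none, and otherwise
  the infimum is attained and is the minimum.\<close>

definition size_eo_ramsey2 :: "'a eo_graph \<Rightarrow> 'b eo_graph \<Rightarrow> enat" where
  "size_eo_ramsey2 G H =
     Inf {enat (card (edges F)) | F :: nat eo_graph. edge_ordered_graph F \<and> eo_arrows F G H}"

definition size_eo_ramsey :: "'a eo_graph \<Rightarrow> enat" where
  "size_eo_ramsey G = size_eo_ramsey2 G G"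

datatype book_vertex = Spine nat | Page nat

definition spine_edges :: "nat \<Rightarrow> book_vertex set set" where
  "spine_edges m = {{Spine i, Spine j} | i j. 1 \<le> i \<and> i < j \<and> j \<le> m}"

definition page_edges :: "nat \<Rightarrow> nat \<Rightarrow> book_vertex set set" where
  "page_edges m n = {{Page i, Spine j} | i j. 1 \<le> i \<and> i \<le> n \<and> 1 \<le> j \<and> j \<le> m}"

definition book :: "nat \<Rightarrow> nat \<Rightarrow> book_vertex eo_graph" where
  "book m n =
     \<lparr> verts = Spine ` {1..m} \<union> Page ` {1..n},
       edges = spine_edges m \<union> page_edges m n,
       edge_less =
         {({Spine i, Spine j}, {Spine s, Spine t}) | i j s t.
            1 \<le> i \<and> i < j \<and> j \<le> m \<and> 1 \<le> s \<and> s < t \<and> t \<le> m \<and> (i < s \<or> i = s \<and> j < t)} \<union>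
         spine_edges m \<times> page_edges m n \<union>
         {({Page i, Spine j}, {Page s, Spine t}) | i j s t.
            1 \<le> i \<and> i \<le> n \<and> 1 \<le> j \<and> j \<le> m \<and> 1 \<le> s \<and> s \<le> n \<and> 1 \<le> t \<and> t \<le> m \<and>
            (i < s \<or> i = s \<and> j < t)} \<rparr>"

lemma edge_ordered_graph_book: "edge_ordered_graph (book m n)"
proof -
  let ?L = "edge_less (book m n)" and ?S = "spine_edges m" and ?P = "page_edges m n"
  define A where "A = {({Spine i, Spine j}, {Spine s, Spine t}) | i j s t.
    1 \<le> i \<and> i < j \<and> j \<le> m \<and> 1 \<le> s \<and> s < t \<and> t \<le> m \<and> (i < s \<or> i = s \<and> j < t)}"
  define B where "B = {({Page i, Spine j}, {Page s, Spine t}) | i j s t.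
    1 \<le> i \<and> i \<le> n \<and> 1 \<le> j \<and> j \<le> m \<and> 1 \<le> s \<and> s \<le> n \<and> 1 \<le> t \<and> t \<le> m \<and>
    (i < s \<or> i = s \<and> j < t)}"
  have L: "?L = A \<union> ?S \<times> ?P \<union> B"
    unfolding book_def A_def B_def by simp
  have sub: "A \<subseteq> ?S \<times> ?S" "B \<subseteq> ?P \<times> ?P"
    unfolding A_def B_def spine_edges_def page_edges_def by blast+
  have disj: "?S \<inter> ?P = {}"
    unfolding spine_edges_def page_edges_def by (auto simp: doubleton_eq_iff)
  have E: "edges (book m n) = ?S \<union> ?P"
    by (simp add: book_def)
  have transA: "trans A"
  proof (rule transI)
    fix x y z assume "(x, y) \<in> A" "(y, z) \<in> A"
    then obtain i j s t s' t' p q where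
      "x = {Spine i, Spine j}" "y = {Spine s, Spine t}" "1 \<le> i" "i < j" "j \<le> m" "s < t"
      "i < s \<or> i = s \<and> j < t"
      "y = {Spine s', Spine t'}" "z = {Spine p, Spine q}" "s' < t'" "1 \<le> p" "p < q" "q \<le> m"
      "s' < p \<or> s' = p \<and> t' < q"
      unfolding A_def by blast
    moreover from this have "s = s'" "t = t'" by (auto simp: doubleton_eq_iff)
    moreover from calculation have "i < p \<or> i = p \<and> j < q" by linarith
    ultimately show "(x, z) \<in> A" unfolding A_def by blast
  qed
  have transB: "trans B"
  proof (rule transI)
    fix x y z assume "(x, y) \<in> B" "(y, z) \<in> B"
    then obtain i j s t s' t' p q where
      "x = {Page i, Spine j}" "y = {Page s, Spine t}" "1 \<le> i" "i \<le> n" "1 \<le> j" "j \<le> m"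
      "i < s \<or> i = s \<and> j < t"
      "y = {Page s', Spine t'}" "z = {Page p, Spine q}" "1 \<le> p" "p \<le> n" "1 \<le> q" "q \<le> m"
      "s' < p \<or> s' = p \<and> t' < q"
      unfolding B_def by blast
    moreover from this have "s = s'" "t = t'" by (auto simp: doubleton_eq_iff)
    moreover from calculation have "i < p \<or> i = p \<and> j < q" by linarith
    ultimately show "(x, z) \<in> B" unfolding B_def by blast
  qed
  have irreflA: "(e, e) \<notin> A" for e
  proof
    assume "(e, e) \<in> A"
    then obtain i j s t where
      "e = {Spine i, Spine j}" "e = {Spine s, Spine t}" "i < j" "s < t" "i < s \<or> i = s \<and> j < t"
      unfolding A_def by blast
    then show False by (auto simp: doubleton_eq_iff)
  qed
  have irreflB: "(e, e) \<notin> B" for e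
  proof
    assume "(e, e) \<in> B"
    then obtain i j s t where
      "e = {Page i, Spine j}" "e = {Page s, Spine t}" "i < s \<or> i = s \<and> j < t"
      unfolding B_def by blast
    then show False by (auto simp: doubleton_eq_iff)
  qed
  have totalA: "(e, e') \<in> A \<or> (e', e) \<in> A" if "e \<in> ?S" "e' \<in> ?S" "e \<noteq> e'" for e e'
  proof -
    from that obtain i j s t where *:
      "e = {Spine i, Spine j}" "1 \<le> i" "i < j" "j \<le> m"
      "e' = {Spine s, Spine t}" "1 \<le> s" "s < t" "t \<le> m"
      unfolding spine_edges_def by blast
    with that have "(i < s \<or> i = s \<and> j < t) \<or> (s < i \<or> s = i \<and> t < j)" by auto
    with * show ?thesis unfolding A_def by blast
  qed
  have totalB: "(e, e') \<in> B \<or> (e', e) \<in> B" if "e \<in> ?P" "e' \<in> ?P" "e \<noteq> e'" for e e'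
  proof -
    from that obtain i j s t where *:
      "e = {Page i, Spine j}" "1 \<le> i" "i \<le> n" "1 \<le> j" "j \<le> m"
      "e' = {Page s, Spine t}" "1 \<le> s" "s \<le> n" "1 \<le> t" "t \<le> m"
      unfolding page_edges_def by blast
    with that have "(i < s \<or> i = s \<and> j < t) \<or> (s < i \<or> s = i \<and> t < j)" by auto
    with * show ?thesis unfolding B_def by blast
  qed
  have "trans ?L"
    unfolding L
  proof (rule transI)
    fix x y z
    assume "(x, y) \<in> A \<union> ?S \<times> ?P \<union> B" "(y, z) \<in> A \<union> ?S \<times> ?P \<union> B"
    then show "(x, z) \<in> A \<union> ?S \<times> ?P \<union> B"
      using sub disj transD[OF transA, of x y z] transD[OF transB, of x y z] by blast
  qed
  moreover have "irrefl ?L"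
    unfolding L irrefl_def using irreflA irreflB disj by blast
  moreover have "total_on (edges (book m n)) ?L"
    unfolding L E total_on_def using totalA totalB by blast
  moreover have "?L \<subseteq> edges (book m n) \<times> edges (book m n)"
    unfolding L E using sub by blast
  moreover have "finite (verts (book m n))"
    by (simp add: book_def)
  moreover have "\<forall>e \<in> edges (book m n). e \<subseteq> verts (book m n) \<and> card e = 2"
  proof
    fix e assume "e \<in> edges (book m n)"
    then consider i j where "e = {Spine i, Spine j}" "1 \<le> i" "i < j" "j \<le> m"
      | i j where "e = {Page i, Spine j}" "1 \<le> i" "i \<le> n" "1 \<le> j" "j \<le> m"
      unfolding E spine_edges_def page_edges_def by blast
    then show "e \<subseteq> verts (book m n) \<and> card e = 2"
      by cases (simp_all add: book_def)
  qed
  ultimately show ?thesis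
    unfolding edge_ordered_graph_def strict_linear_order_on_def by blast
qed

end

theory Submission
  imports Defs "HOL-Library.FuncSet" "HOL-Library.Product_Lexorder" "HOL-Library.Ramsey"
begin

text \<open>Lower bound: the edge order plays no role. Rank the vertices by decreasing degree and cut the
  first ones into \<open>J\<close> parts (about \<open>m / 2\<close>) of size about \<open>n / 16\<close>. Edges inside a part are red, edges
  between different parts are blue, and all other edges are coloured at random, an edge leaving
  part \<open>j\<close> being red with probability \<open>(j / J) powr (1 / m) / 2\<close>. A red clique inside part \<open>j\<close> has its
  large degree compensated by this bias, whereas a blue spine meets each part at most once, and the
  product of the resulting factors \<open>2 - (j / J) powr (1 / m)\<close> is bounded, so it costs only a constant.

  Upper bound: the host is a complete graph on \<open>4 * m\<close> blocks of \<open>8 * n\<close> vertices, joined to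
  \<open>2 ^ (m + 4) * n\<close> further vertices. Half of the blocks are rich in large cliques of one colour, say
  red. Going through these blocks, either a red clique is found that is completely blue to the
  cliques found before, at the price of shrinking these, or a fixed fraction of the block is
  completely red to one of the shrunken cliques. The second case cannot occur often without creating
  a red book whose pages lie in the blocks. So \<open>m\<close> red cliques with all edges between them blue are
  found, and averaging the inequality \<open>(\<Prod>i. x i) + (\<Sum>i. (1 - x i) ^ m) / m \<ge> 1 / (3 * 2 ^ m)\<close> over the
  further vertices yields either a blue book with one spine vertex in each clique or a red book with
  its spine in a single clique.\<close>

section \<open>Random colourings\<close>

text \<open>A uniformly random colouring suffices against every spine that has a vertex of degree of
  order at most \<open>2 ^ m * n\<close>. With fewer than about \<open>m * 2 ^ m * n\<^sup>2\<close>
  edges, the number of vertices of larger degree can still be of order \<open>m * n\<close>; giving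
  about that many vertices a special treatment is what produces the factor \<open>m\<close>. The
  number \<open>J\<close> of parts must stay below \<open>m\<close>, so that a blue spine has a
  vertex outside all of them; taking it near \<open>m / 2\<close> leaves so many outside vertices
  that blue pages inside the parts are rare as well.

  In the upper bound the clique sizes depend on \<open>m\<close> alone, so Ramsey's theorem supplies
  them once \<open>n\<close> is large. Of \<open>4 * m\<close> blocks, \<open>2 * m\<close> favour
  one colour. If fewer than \<open>m\<close> of these yield a clique, then at least \<open>m\<close>
  were skipped, more than there are cliques to account for them, which forces \<open>n\<close> pages
  on a single clique. The averaged inequality has the right order: a random colouring corresponds to
  all \<open>x i\<close> being \<open>1 / 2\<close> and gives \<open>2 / 2 ^ m\<close>.\<close>

definition random_weight :: "('e \<Rightarrow> real) \<Rightarrow> 'e set \<Rightarrow> 'e set \<Rightarrow> real" where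
  "random_weight p E R = (\<Prod>e\<in>R. p e) * (\<Prod>e\<in>E - R. 1 - p e)"

lemma random_weight_nonneg:
  assumes "\<And>e. e \<in> E \<Longrightarrow> 0 \<le> p e \<and> p e \<le> 1" "R \<subseteq> E"
  shows "0 \<le> random_weight p E R"
  unfolding random_weight_def using assms by (intro mult_nonneg_nonneg prod_nonneg) auto

lemma sum_random_weight:
  assumes "finite E"
  shows "(\<Sum>R\<in>Pow E. random_weight p E R) = 1"
  using prod_add[OF assms, of p "\<lambda>e. 1 - p e"] by (simp add: random_weight_def)

text \<open>The event \<open>T \<subseteq> R\<close> leaves the edges outside \<open>T\<close> free,
  and their weights sum to 1 by \<open>sum_random_weight\<close>.\<close>

lemma sum_random_weight_superset:
  assumes E: "finite E" and T: "T \<subseteq> E"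
  shows "(\<Sum>R | R \<subseteq> E \<and> T \<subseteq> R. random_weight p E R) = (\<Prod>e\<in>T. p e)"
proof -
  have fT: "finite T" using E T by (rule rev_finite_subset)
  have "(\<Sum>R | R \<subseteq> E \<and> T \<subseteq> R. random_weight p E R)
      = (\<Sum>S\<in>Pow (E - T). random_weight p E (T \<union> S))"
    by (rule sum.reindex_bij_witness[where i = "\<lambda>S. T \<union> S" and j = "\<lambda>R. R - T"])
      (use T in \<open>auto intro!: arg_cong[where f = "random_weight p E"]\<close>)
  also have "\<dots> = (\<Sum>S\<in>Pow (E - T). (\<Prod>e\<in>T. p e) * random_weight p (E - T) S)"
  proof (rule sum.cong)
    fix S assume "S \<in> Pow (E - T)"
    then have S: "S \<subseteq> E - T" by simp
    have "finite S" using S E finite_subset by blast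
    then have "(\<Prod>e\<in>T \<union> S. p e) = (\<Prod>e\<in>T. p e) * (\<Prod>e\<in>S. p e)"
      using fT S by (intro prod.union_disjoint) auto
    moreover have "E - (T \<union> S) = E - T - S" by auto
    ultimately show "random_weight p E (T \<union> S) = (\<Prod>e\<in>T. p e) * random_weight p (E - T) S"
      by (simp add: random_weight_def)
  qed simp
  also have "\<dots> = (\<Prod>e\<in>T. p e)"
    using E by (simp add: sum_distrib_left[symmetric] sum_random_weight)
  finally show ?thesis .
qed

lemma card_subsets_weight:
  assumes "finite N"
  shows "(2::real) ^ card {v\<in>N. P v} = (\<Sum>V\<in>Pow N. if \<forall>v\<in>V. P v then 1 else 0)"
proof -
  have "Pow N \<inter> {V. \<forall>v\<in>V. P v} = Pow {v\<in>N. P v}" by auto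
  then show ?thesis using assms by (simp add: sum.If_cases card_Pow)
qed

text \<open>Markov's inequality for \<open>2 ^ X\<close>, \<open>X\<close> being the number of \<open>v\<close> with \<open>T v \<subseteq> R\<close>: writing \<open>2 ^ X\<close> as the
  number of sets of such \<open>v\<close> reduces its expectation to probabilities of the form \<open>T \<subseteq> R\<close>.\<close>

lemma random_weight_tail:
  fixes p :: "'e \<Rightarrow> real" and T :: "'v \<Rightarrow> 'e set"
  assumes E: "finite E" and p: "\<And>e. e \<in> E \<Longrightarrow> 0 \<le> p e \<and> p e \<le> 1"
    and N: "finite N" and T: "\<And>v. v \<in> N \<Longrightarrow> T v \<subseteq> E"
    and disj: "\<And>v w. v \<in> N \<Longrightarrow> w \<in> N \<Longrightarrow> v \<noteq> w \<Longrightarrow> T v \<inter> T w = {}"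
  shows "(\<Sum>R | R \<subseteq> E \<and> n \<le> card {v\<in>N. T v \<subseteq> R}. random_weight p E R)
    \<le> exp (\<Sum>v\<in>N. \<Prod>e\<in>T v. p e) / 2 ^ n"
proof -
  have nn: "R \<subseteq> E \<Longrightarrow> 0 \<le> random_weight p E R" for R
    using random_weight_nonneg[of E p R] p by blast
  have "2 ^ n * (\<Sum>R | R \<subseteq> E \<and> n \<le> card {v\<in>N. T v \<subseteq> R}. random_weight p E R)
      = (\<Sum>R | R \<subseteq> E \<and> n \<le> card {v\<in>N. T v \<subseteq> R}. random_weight p E R * 2 ^ n)"
    by (simp add: sum_distrib_left mult.commute)
  also have "\<dots> \<le> (\<Sum>R | R \<subseteq> E \<and> n \<le> card {v\<in>N. T v \<subseteq> R}.
      random_weight p E R * 2 ^ card {v\<in>N. T v \<subseteq> R})"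
    using nn by (intro sum_mono mult_left_mono power_increasing) auto
  also have "\<dots> \<le> (\<Sum>R\<in>Pow E. random_weight p E R * 2 ^ card {v\<in>N. T v \<subseteq> R})"
    using nn E by (intro sum_mono2) auto
  also have "\<dots> = (\<Sum>R\<in>Pow E. \<Sum>V\<in>Pow N. if \<forall>v\<in>V. T v \<subseteq> R then random_weight p E R else 0)"
    by (simp add: card_subsets_weight[OF N] sum_distrib_left if_distrib cong: if_cong)
  also have "\<dots> = (\<Sum>V\<in>Pow N. \<Sum>R\<in>Pow E. if \<forall>v\<in>V. T v \<subseteq> R then random_weight p E R else 0)"
    by (rule sum.swap)
  also have "\<dots> = (\<Sum>V\<in>Pow N. \<Prod>v\<in>V. \<Prod>e\<in>T v. p e)"
  proof (rule sum.cong)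
    fix V assume "V \<in> Pow N"
    then have V: "V \<subseteq> N" by simp
    have *: "Pow E \<inter> {R. \<forall>v\<in>V. T v \<subseteq> R} = {R. R \<subseteq> E \<and> (\<Union>v\<in>V. T v) \<subseteq> R}" by auto
    have "(\<Sum>R\<in>Pow E. if \<forall>v\<in>V. T v \<subseteq> R then random_weight p E R else 0)
        = (\<Sum>R | R \<subseteq> E \<and> (\<Union>v\<in>V. T v) \<subseteq> R. random_weight p E R)"
      using E by (simp add: sum.If_cases *)
    also have "\<dots> = (\<Prod>e\<in>(\<Union>v\<in>V. T v). p e)"
      using V T by (intro sum_random_weight_superset[OF E]) blast
    \<comment> \<open>Disjointness of the \<open>T v\<close> makes the events
      \<open>T v \<subseteq> R\<close> independent.\<close>
    also have "\<dots> = (\<Prod>v\<in>V. \<Prod>e\<in>T v. p e)"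
    proof (rule prod.UNION_disjoint)
      show "finite V" using V N by (rule finite_subset)
      show "\<forall>v\<in>V. finite (T v)" using V T E by (meson finite_subset subsetD)
      show "\<forall>v\<in>V. \<forall>w\<in>V. v \<noteq> w \<longrightarrow> T v \<inter> T w = {}" using V disj by blast
    qed
    finally show "(\<Sum>R\<in>Pow E. if \<forall>v\<in>V. T v \<subseteq> R then random_weight p E R else 0)
        = (\<Prod>v\<in>V. \<Prod>e\<in>T v. p e)" .
  qed simp
  also have "\<dots> = (\<Prod>v\<in>N. (\<Prod>e\<in>T v. p e) + 1)"
    using prod_add[OF N, of "\<lambda>v. \<Prod>e\<in>T v. p e" "\<lambda>_. 1"] by simp
  also have "\<dots> \<le> (\<Prod>v\<in>N. exp (\<Prod>e\<in>T v. p e))"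
  proof (rule prod_mono)
    fix v assume "v \<in> N"
    then have "0 \<le> (\<Prod>e\<in>T v. p e)" using p T by (intro prod_nonneg) blast
    then show "0 \<le> (\<Prod>e\<in>T v. p e) + 1 \<and> (\<Prod>e\<in>T v. p e) + 1 \<le> exp (\<Prod>e\<in>T v. p e)"
      using exp_ge_add_one_self[of "\<Prod>e\<in>T v. p e"] by (simp add: add.commute)
  qed
  also have "\<dots> = exp (\<Sum>v\<in>N. \<Prod>e\<in>T v. p e)" using N by (simp add: exp_sum)
  finally show ?thesis by (simp add: field_simps)
qed

text \<open>Passing from \<open>R\<close> to \<open>E - R\<close> exchanges \<open>p\<close> with
  \<open>1 - p\<close>.\<close>

lemma random_weight_tail_compl:
  fixes p :: "'e \<Rightarrow> real" and T :: "'v \<Rightarrow> 'e set"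
  assumes E: "finite E" and p: "\<And>e. e \<in> E \<Longrightarrow> 0 \<le> p e \<and> p e \<le> 1"
    and N: "finite N" and T: "\<And>v. v \<in> N \<Longrightarrow> T v \<subseteq> E"
    and disj: "\<And>v w. v \<in> N \<Longrightarrow> w \<in> N \<Longrightarrow> v \<noteq> w \<Longrightarrow> T v \<inter> T w = {}"
  shows "(\<Sum>R | R \<subseteq> E \<and> n \<le> card {v\<in>N. T v \<subseteq> E - R}. random_weight p E R)
    \<le> exp (\<Sum>v\<in>N. \<Prod>e\<in>T v. 1 - p e) / 2 ^ n"
proof -
  have "(\<Sum>R | R \<subseteq> E \<and> n \<le> card {v\<in>N. T v \<subseteq> E - R}. random_weight p E R)
     = (\<Sum>R | R \<subseteq> E \<and> n \<le> card {v\<in>N. T v \<subseteq> R}. random_weight (\<lambda>e. 1 - p e) E R)"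
  proof (rule sum.reindex_bij_witness[where i = "\<lambda>R. E - R" and j = "\<lambda>R. E - R"])
    fix R assume "R \<in> {R. R \<subseteq> E \<and> n \<le> card {v \<in> N. T v \<subseteq> R}}"
    then have "E - (E - R) = R" by auto
    then show "E - R \<in> {R. R \<subseteq> E \<and> n \<le> card {v \<in> N. T v \<subseteq> E - R}}"
      using \<open>R \<in> _\<close> by auto
  next
    fix R assume "R \<in> {R. R \<subseteq> E \<and> n \<le> card {v \<in> N. T v \<subseteq> E - R}}"
    then have "E - (E - R) = R" by auto
    then show "random_weight (\<lambda>e. 1 - p e) E (E - R) = random_weight p E R"
      by (simp add: random_weight_def)
  qed auto
  also have "\<dots> \<le> exp (\<Sum>v\<in>N. \<Prod>e\<in>T v. 1 - p e) / 2 ^ n"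
    by (rule random_weight_tail) (use assms in auto)
  finally show ?thesis .
qed

section \<open>Partition by degree\<close>

lemma power_div_fact_le_exp:
  assumes "0 \<le> x"
  shows "x ^ n / fact n \<le> exp (x::real)"
proof -
  have "(\<Sum>k\<in>{n}. inverse (fact k) *\<^sub>R x ^ k) \<le> (\<Sum>k. inverse (fact k) *\<^sub>R x ^ k)"
    by (rule sum_le_suminf) (use assms summable_exp[of x] in auto)
  then show ?thesis by (simp add: exp_def divide_inverse mult.commute)
qed

text \<open>For positive \<open>J\<close> the product is \<open>J ^ (J - 1) / fact (J - 1)\<close>,
  a single term of the series of \<open>exp J\<close>.\<close>

lemma prod_ratio_le_exp: "(\<Prod>j=1..<J. real J / real j) \<le> exp (real J)"
proof (cases J)
  case (Suc k)
  have "(\<Prod>j=1..<J. real J / real j) = real J ^ k / fact k"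
    unfolding Suc by (simp add: prod_dividef fact_prod atLeastLessThanSuc_atLeastAtMost)
  then show ?thesis using power_div_fact_le_exp[of "real J" k] by simp
qed simp

text \<open>Twice the red probability of an edge from part \<open>j\<close> to the outside. A vertex
  of part \<open>j > 0\<close> has degree at most \<open>2 * e / (j * q)\<close>, where
  \<open>q\<close> is the part size; the root makes the \<open>m\<close>-th power of the probability
  proportional to \<open>j\<close>, which cancels this \<open>j\<close>.\<close>

definition part_prob :: "nat \<Rightarrow> nat \<Rightarrow> nat \<Rightarrow> real" where
  "part_prob m J j = root m (real j / real J)"

lemma part_prob_simps [simp]:
  assumes "0 < m" "0 < J"
  shows "part_prob m J 0 = 0" "part_prob m J J = 1"
  using assms by (simp_all add: part_prob_def)

lemma part_prob_bounds:
  assumes "0 < m" "j \<le> J"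
  shows "0 \<le> part_prob m J j" "part_prob m J j \<le> 1"
  using assms by (auto simp: part_prob_def divide_le_eq_1)

lemma part_prob_power:
  assumes "0 < m"
  shows "part_prob m J j ^ m = real j / real J"
  using assms by (simp add: part_prob_def)

lemma two_minus_le_inverse:
  assumes "0 < (t::real)"
  shows "2 - t \<le> 1 / t"
proof -
  have "0 \<le> (t - 1)\<^sup>2" by simp
  then have "(2 - t) * t \<le> 1" by (simp add: power2_eq_square algebra_simps)
  then show ?thesis using assms by (simp add: field_simps)
qed

text \<open>The total loss on a blue spine with one vertex in every part. Part 0 contributes the
  factor 2. For the others, \<open>2 - t \<le> 1 / t\<close> bounds the product by the
  \<open>m\<close>-th root of \<open>\<Prod>j=1..<J. J / j\<close>, hence by the \<open>m\<close>-th
  root of \<open>exp J\<close>, which is at most \<open>exp 1 \<le> 3\<close> because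
  \<open>J \<le> m\<close>.\<close>

lemma prod_two_minus_part_prob_le:
  assumes "0 < J" "J \<le> m"
  shows "(\<Prod>j<J. 2 - part_prob m J j) \<le> 6"
proof -
  have m: "0 < m" using assms by simp
  have pos: "0 < part_prob m J j" if "j \<in> {1..<J}" for j
    using that m by (simp add: part_prob_def)
  define P where "P = (\<Prod>j=1..<J. 1 / part_prob m J j)"
  have P0: "0 \<le> P" unfolding P_def using pos by (intro prod_nonneg) (simp add: less_imp_le)
  have "P ^ m = (\<Prod>j=1..<J. real J / real j)"
    unfolding P_def prod_power_distrib
    by (intro prod.cong) (use m in \<open>auto simp: power_divide part_prob_power\<close>)
  also have "\<dots> \<le> exp (real J)" by (rule prod_ratio_le_exp)
  also have "\<dots> \<le> exp (real m)" using assms by simp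
  also have "\<dots> = exp 1 ^ m" by (simp add: exp_of_nat_mult[symmetric])
  finally have "P \<le> exp 1" using m P0 by (simp add: power_mono_iff)
  then have P3: "P \<le> 3" using exp_le by linarith
  have "{..<J} = insert 0 {1..<J}" using assms by auto
  then have "(\<Prod>j<J. 2 - part_prob m J j) = 2 * (\<Prod>j=1..<J. 2 - part_prob m J j)"
    using m assms by simp
  also have "\<dots> \<le> 2 * P"
    unfolding P_def
  proof (intro mult_left_mono prod_mono)
    fix j assume j: "j \<in> {1..<J}"
    then have "part_prob m J j \<le> 1" using m part_prob_bounds(2)[of m j J] by simp
    then show "0 \<le> 2 - part_prob m J j \<and> 2 - part_prob m J j \<le> 1 / part_prob m J j"
      using pos[OF j] two_minus_le_inverse by simp
  qed simp
  finally show ?thesis using P3 by simp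
qed

text \<open>Parts \<open>0, \<dots>, J - 1\<close> hold the vertices of high degree, part \<open>J\<close> all the others.\<close>

definition red_prob :: "nat \<Rightarrow> nat \<Rightarrow> nat \<Rightarrow> nat \<Rightarrow> real" where
  "red_prob m J i j = (if i < J \<and> j < J then if i = j then 1 else 0 else part_prob m J (min i j) / 2)"

lemma red_prob_commute: "red_prob m J i j = red_prob m J j i"
  by (auto simp: red_prob_def min.commute)

lemma red_prob_bounds:
  assumes "0 < m" "i \<le> J" "j \<le> J"
  shows "0 \<le> red_prob m J i j" "red_prob m J i j \<le> 1"
  using part_prob_bounds[OF assms(1), of "min i j" J] assms by (auto simp: red_prob_def)

lemma red_prob_outside:
  assumes "j \<le> J"
  shows "red_prob m J J j = part_prob m J j / 2" "red_prob m J j J = part_prob m J j / 2"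
  using assms by (auto simp: red_prob_def)

text \<open>The quotient \<open>J * J / 2 ^ (J - 1)\<close> is largest at \<open>J = 3\<close>, with
  value \<open>9 / 4\<close>. The bound controls blue pages inside the parts: there are at most
  \<open>J\<close> parts, each losing a factor of at most \<open>J\<close>, against a gain of
  \<open>2 ^ (m - J)\<close>.\<close>

lemma square_le_power: "1 \<le> J \<Longrightarrow> J * J \<le> 3 * 2 ^ (J - 1)" for J :: nat
proof (induction J rule: nat_induct_at_least)
  case (Suc n)
  consider "n = 1" | "n = 2" | "3 \<le> n" using Suc by linarith
  then show ?case
  proof cases
    case 3
    then have "3 * n \<le> n * n" by simp
    then have "Suc n * Suc n \<le> 2 * (n * n)"
      using 3 unfolding mult_Suc mult_Suc_right by linarith
    also have "\<dots> \<le> 2 * (3 * 2 ^ (n - 1))" using Suc.IH by simp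
    also have "\<dots> = 3 * 2 ^ (Suc n - 1)" using 3 by (cases n) auto
    finally show ?thesis .
  qed simp_all
qed simp

text \<open>Here \<open>nb\<close> stands for the neighbourhood and \<open>e\<close> for the number
  of edges. The origin of \<open>part_degree\<close>: at least \<open>\<pi> v * q\<close> vertices
  precede \<open>v\<close> in the ranking, all of degree at least that of \<open>v\<close>, and the
  degrees sum to at most \<open>2 * e\<close>.\<close>

locale degree_partition =
  fixes V :: "'v set" and nb :: "'v \<Rightarrow> 'v set" and \<pi> :: "'v \<Rightarrow> nat" and m J q e :: nat
  assumes V: "finite V"
    and nb: "\<And>u. u \<in> V \<Longrightarrow> nb u \<subseteq> V"
    and m: "2 \<le> m" and J: "J = (m + 1) div 2" and q: "0 < q"
    and part_le: "\<And>v. \<pi> v \<le> J"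
    and card_part: "\<And>j. j < J \<Longrightarrow> card {v\<in>V. \<pi> v = j} \<le> q"
    and part_degree: "\<And>v. v \<in> V \<Longrightarrow> \<pi> v * q * card (nb v) \<le> 2 * e"
begin

lemma J_bounds: "0 < J" "J < m" using m J by auto

lemma degree_outside:
  assumes "v \<in> V" "\<pi> v = J"
  shows "real (card (nb v)) \<le> 2 * real e / (real J * real q)"
proof -
  have "real (J * q * card (nb v)) \<le> real (2 * e)"
    using part_degree[OF assms(1)] assms(2) by (simp only: of_nat_le_iff)
  then show ?thesis using J_bounds q by (simp add: field_simps)
qed

text \<open>By \<open>mono\<close>, the spine \<open>K\<close> can be red with positive probability,
  so it meets at most one part below \<open>J\<close>. If it meets one, pages inside the parts have
  to lie in that same part, which has at most \<open>q\<close> vertices. For the other pages, either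
  \<open>K\<close> has an outside vertex, whose degree is small, or \<open>K\<close> lies in a
  single part, where the bias compensates the degree.\<close>

lemma red_pages:
  assumes K: "K \<subseteq> V" "card K = m"
    and W: "\<And>u. u \<in> K \<Longrightarrow> W \<subseteq> nb u"
    and mono: "\<And>u v. u \<in> K \<Longrightarrow> v \<in> K \<Longrightarrow> u \<noteq> v \<Longrightarrow> red_prob m J (\<pi> u) (\<pi> v) \<noteq> 0"
  shows "(\<Sum>v\<in>W. \<Prod>u\<in>K. red_prob m J (\<pi> u) (\<pi> v))
    \<le> real q + 2 * real e / (2 ^ m * real J * real q)"
proof -
  have m0: "0 < m" using m by simp
  have fK: "finite K" "K \<noteq> {}" using K V finite_subset m by auto
  then obtain u0 where u0: "u0 \<in> K" by blast
  have fnb: "finite (nb u)" if "u \<in> K" for u using that nb K V finite_subset by (metis subsetD)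
  have WV: "W \<subseteq> V" using W[OF u0] nb[of u0] u0 K by blast
  then have fW: "finite W" using V finite_subset by blast
  let ?f = "\<lambda>v. \<Prod>u\<in>K. red_prob m J (\<pi> u) (\<pi> v)"
  have f1: "?f v \<le> 1" for v
    by (intro prod_le_1) (use red_prob_bounds m0 part_le in auto)
  have one_part: "(\<Sum>v\<in>{v\<in>W. \<pi> v < J}. ?f v) \<le> real q" if u: "u \<in> K" "\<pi> u < J" for u
  proof -
    have "(\<Sum>v\<in>{v\<in>W. \<pi> v < J}. ?f v) = (\<Sum>v\<in>{v\<in>W. \<pi> v = \<pi> u}. ?f v)"
    proof (rule sum.mono_neutral_right)
      show "\<forall>v\<in>{v \<in> W. \<pi> v < J} - {v \<in> W. \<pi> v = \<pi> u}. ?f v = 0"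
        using u fK by (auto simp: red_prob_def intro!: bexI[of _ u])
    qed (use fW u in auto)
    also have "\<dots> \<le> (\<Sum>v\<in>{v\<in>W. \<pi> v = \<pi> u}. 1)" using f1 by (intro sum_mono)
    also have "\<dots> \<le> real (card {v\<in>V. \<pi> v = \<pi> u})"
      using WV V by (auto intro!: card_mono)
    also have "\<dots> \<le> real q" using card_part u by simp
    finally show ?thesis .
  qed
  have split: "(\<Sum>v\<in>W. ?f v) = (\<Sum>v\<in>{v\<in>W. \<pi> v < J}. ?f v) + (\<Sum>v\<in>{v\<in>W. \<pi> v = J}. ?f v)"
    using fW part_le by (subst sum.union_disjoint[symmetric]) (auto intro!: sum.cong simp: nat_less_le)
  have half: "?f v \<le> (1/2) ^ m" if "\<And>u. u \<in> K \<Longrightarrow> \<pi> u = J \<or> \<pi> v = J" for v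
  proof -
    have "?f v \<le> (\<Prod>u\<in>K. 1/2)"
    proof (rule prod_mono)
      fix u assume u: "u \<in> K"
      have "red_prob m J (\<pi> u) (\<pi> v) = part_prob m J (min (\<pi> u) (\<pi> v)) / 2"
        using that[OF u] by (auto simp: red_prob_def)
      then show "0 \<le> red_prob m J (\<pi> u) (\<pi> v) \<and> red_prob m J (\<pi> u) (\<pi> v) \<le> 1/2"
        using part_prob_bounds[OF m0 min.coboundedI1[OF part_le[of u]], of "\<pi> v"] by simp
    qed
    then show ?thesis using K by simp
  qed
  have few: "(\<Sum>v\<in>X. ?f v) \<le> 2 * real e / (2 ^ m * real J * real q)"
    if X: "X \<subseteq> W" "\<And>v u. v \<in> X \<Longrightarrow> u \<in> K \<Longrightarrow> \<pi> u = J \<or> \<pi> v = J" and w: "w \<in> K" "\<pi> w = J"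
    for X w
  proof -
    have "(\<Sum>v\<in>X. ?f v) \<le> (\<Sum>v\<in>X. (1/2) ^ m)" using half X by (intro sum_mono) blast
    also have "\<dots> = real (card X) / 2 ^ m" by (simp add: power_one_over)
    also have "\<dots> \<le> real (card (nb w)) / 2 ^ m"
      using X W[OF w(1)] fnb[OF w(1)] by (intro divide_right_mono) (auto intro!: card_mono)
    also have "\<dots> \<le> (2 * real e / (real J * real q)) / 2 ^ m"
      using degree_outside[of w] w K by (intro divide_right_mono) auto
    finally show ?thesis by (simp add: ac_simps)
  qed
  have e0: "0 \<le> 2 * real e / (2 ^ m * real J * real q)" by simp
  show ?thesis
  proof (cases "\<exists>w\<in>K. \<pi> w = J")
    case True
    then obtain w where w: "w \<in> K" "\<pi> w = J" by blast
    show ?thesis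
    proof (cases "\<exists>u\<in>K. \<pi> u < J")
      case True
      then obtain u where "u \<in> K" "\<pi> u < J" by blast
      then have "(\<Sum>v\<in>{v\<in>W. \<pi> v < J}. ?f v) \<le> real q" by (rule one_part)
      moreover have "(\<Sum>v\<in>{v\<in>W. \<pi> v = J}. ?f v) \<le> 2 * real e / (2 ^ m * real J * real q)"
        by (rule few[OF _ _ w]) auto
      ultimately show ?thesis unfolding split by (rule add_mono)
    next
      case False
      then have "\<pi> u = J" if "u \<in> K" for u using part_le[of u] that by force
      then have "(\<Sum>v\<in>W. ?f v) \<le> 2 * real e / (2 ^ m * real J * real q)"
        by (intro few[OF _ _ w]) auto
      then show ?thesis by (rule order_trans) simp
    qed
  next
    case False
    then have K1: "\<pi> u < J" if "u \<in> K" for u using part_le[of u] that by (metis le_neq_implies_less)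
    have same: "\<pi> u = \<pi> u0" if "u \<in> K" for u
      using mono[OF that u0] K1[OF that] K1[OF u0]
      by (cases "u = u0") (auto simp: red_prob_def split: if_splits)
    \<comment> \<open>The numerator \<open>\<pi> u0\<close> produced here is the one that
      \<open>part_degree\<close> absorbs below.\<close>
    have "(\<Sum>v\<in>{v\<in>W. \<pi> v = J}. ?f v) = (\<Sum>v\<in>{v\<in>W. \<pi> v = J}. real (\<pi> u0) / real J / 2 ^ m)"
    proof (rule sum.cong)
      fix v assume "v \<in> {v\<in>W. \<pi> v = J}"
      then have v: "\<pi> v = J" by simp
      have "?f v = (\<Prod>u\<in>K. part_prob m J (\<pi> u0) / 2)"
      proof (rule prod.cong)
        fix u assume "u \<in> K"
        show "red_prob m J (\<pi> u) (\<pi> v) = part_prob m J (\<pi> u0) / 2"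
          unfolding same[OF \<open>u \<in> K\<close>] v by (rule red_prob_outside(2)[OF part_le])
      qed simp
      then show "?f v = real (\<pi> u0) / real J / 2 ^ m"
        using K m0 by (simp add: power_divide part_prob_power)
    qed simp
    also have "\<dots> = real (\<pi> u0) * real (card {v\<in>W. \<pi> v = J}) / real J / 2 ^ m" by simp
    also have "\<dots> \<le> real (\<pi> u0) * real (card (nb u0)) / real J / 2 ^ m"
      using W[OF u0] fnb[OF u0]
      by (intro divide_right_mono mult_left_mono) (auto intro!: card_mono)
    also have "\<dots> \<le> (2 * real e / real q) / real J / 2 ^ m"
    proof (intro divide_right_mono)
      have "real (\<pi> u0 * q * card (nb u0)) \<le> real (2 * e)"
        using part_degree[of u0] u0 K by (metis of_nat_le_iff subsetD)
      then show "real (\<pi> u0) * real (card (nb u0)) \<le> 2 * real e / real q"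
        using q by (simp add: field_simps)
    qed simp_all
    finally have "(\<Sum>v\<in>{v\<in>W. \<pi> v = J}. ?f v) \<le> 2 * real e / (2 ^ m * real J * real q)"
      by (simp add: ac_simps)
    with one_part[OF u0 K1[OF u0]] show ?thesis unfolding split by (rule add_mono)
  qed
qed

text \<open>By \<open>mono\<close>, the spine has at most one vertex in each part, so at least
  \<open>m - J\<close> of its vertices lie outside and have small degree. A page outside all parts
  is blue to \<open>K\<close> with probability \<open>2 ^ m\<close> in the denominator and
  \<open>\<Prod>u\<in>K1. 2 - part_prob m J (\<pi> u)\<close> in the numerator, and the latter is at
  most 6. For a page inside a part, only the factors of the outside spine vertices are kept.\<close>

lemma blue_pages:
  assumes K: "K \<subseteq> V" "card K = m"
    and W: "\<And>u. u \<in> K \<Longrightarrow> W \<subseteq> nb u"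
    and mono: "\<And>u v. u \<in> K \<Longrightarrow> v \<in> K \<Longrightarrow> u \<noteq> v \<Longrightarrow> red_prob m J (\<pi> u) (\<pi> v) \<noteq> 1"
  shows "(\<Sum>v\<in>W. \<Prod>u\<in>K. 1 - red_prob m J (\<pi> u) (\<pi> v))
    \<le> 4 * real q + 12 * real e / (2 ^ m * real J * real q)"
proof -
  have m0: "0 < m" using m by simp
  have fK: "finite K" using K(1) V by (rule finite_subset)
  define K1 where "K1 = {u\<in>K. \<pi> u < J}"
  define K2 where "K2 = {u\<in>K. \<pi> u = J}"
  have K12: "K = K1 \<union> K2" "K1 \<inter> K2 = {}" "finite K1" "finite K2"
    unfolding K1_def K2_def using fK part_le by (auto simp: nat_less_le)
  have inj: "inj_on \<pi> K1"
  proof (rule inj_onI)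
    fix u v assume "u \<in> K1" "v \<in> K1" "\<pi> u = \<pi> v"
    then have "u \<in> K" "v \<in> K" "red_prob m J (\<pi> u) (\<pi> v) = 1"
      by (simp_all add: K1_def red_prob_def)
    then show "u = v" using mono by blast
  qed
  have "\<pi> ` K1 \<subseteq> {..<J}" by (auto simp: K1_def)
  from card_inj_on_le[OF inj this] have cK1: "card K1 \<le> J" by simp
  have cK: "card K1 + card K2 = m" using K K12 by (metis card_Un_disjoint)
  then have cK2: "m - J \<le> card K2" using cK1 by simp
  have "card K2 \<noteq> 0" using cK2 J_bounds by simp
  then obtain w where w: "w \<in> K" "\<pi> w = J" by (auto simp: K2_def card_eq_0_iff)
  have fnb: "finite (nb w)" using w nb K V finite_subset by (metis subsetD)
  have WV: "W \<subseteq> V" using W[OF w(1)] nb[of w] w K by blast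
  then have fW: "finite W" using V finite_subset by blast
  let ?g = "\<lambda>u v. 1 - red_prob m J (\<pi> u) (\<pi> v)"
  let ?f = "\<lambda>v. \<Prod>u\<in>K. ?g u v"
  have g01: "0 \<le> ?g u v \<and> ?g u v \<le> 1" for u v
    using red_prob_bounds[OF m0 part_le[of u] part_le[of v]] by simp
  have out: "?f v \<le> 6 / 2 ^ m" if "\<pi> v = J" for v
  proof -
    have "?f v = (\<Prod>u\<in>K. (2 - part_prob m J (\<pi> u)) / 2)"
      using that part_le by (intro prod.cong) (auto simp: red_prob_outside field_simps)
    also have "\<dots> = (\<Prod>u\<in>K. 2 - part_prob m J (\<pi> u)) / 2 ^ m"
      using K by (simp add: prod_dividef)
    also have "(\<Prod>u\<in>K. 2 - part_prob m J (\<pi> u)) = (\<Prod>u\<in>K1. 2 - part_prob m J (\<pi> u))"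
      unfolding K12(1) prod.union_disjoint[OF K12(3,4,2)] using m0 J_bounds
      by (simp add: K2_def)
    also have "\<dots> = (\<Prod>j\<in>\<pi> ` K1. 2 - part_prob m J j)"
      using inj by (simp add: prod.reindex)
    also have "\<dots> \<le> (\<Prod>j<J. 2 - part_prob m J j)"
    proof (rule prod_mono2)
      fix j assume "j \<in> {..<J} - \<pi> ` K1"
      then show "1 \<le> 2 - part_prob m J j"
        using part_prob_bounds[OF m0, of j J] by simp
    next
      fix j assume "j \<in> \<pi> ` K1"
      then show "0 \<le> 2 - part_prob m J j"
        using part_prob_bounds[OF m0, of j J] part_le by fastforce
    qed (auto simp: K1_def)
    also have "\<dots> \<le> 6" using J_bounds by (intro prod_two_minus_part_prob_le) auto
    finally show ?thesis by (simp add: divide_right_mono)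
  qed
  have inside: "?f v \<le> (1 - part_prob m J (\<pi> v) / 2) ^ (m - J)" if "\<pi> v < J" for v
  proof -
    have "?f v = (\<Prod>u\<in>K1. ?g u v) * (\<Prod>u\<in>K2. ?g u v)"
      unfolding K12(1) by (rule prod.union_disjoint[OF K12(3,4,2)])
    also have "\<dots> \<le> 1 * (\<Prod>u\<in>K2. ?g u v)"
      using g01 by (intro mult_right_mono prod_le_1 prod_nonneg) blast+
    also have "\<dots> = (1 - part_prob m J (\<pi> v) / 2) ^ card K2"
      using part_le by (simp add: K2_def red_prob_outside)
    also have "\<dots> \<le> (1 - part_prob m J (\<pi> v) / 2) ^ (m - J)"
      using part_prob_bounds[OF m0 part_le[of v]] cK2 by (intro power_decreasing) auto
    finally show ?thesis .
  qed
  \<comment> \<open>After \<open>2 - t \<le> 1 / t\<close>, the exponent may be raised to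
    \<open>m\<close> because \<open>1 / t \<ge> 1\<close>; this removes the root and leaves
    \<open>J / j \<le> J\<close>.\<close>
  have inside': "(1 - part_prob m J j / 2) ^ (m - J) \<le> real J / 2 ^ (m - J)"
    if j: "j \<in> {1..<J}" for j
  proof -
    have t: "0 < part_prob m J j" "part_prob m J j \<le> 1"
      using j m0 part_prob_bounds[OF m0, of j J] by (auto simp: part_prob_def)
    have "(2 - part_prob m J j) ^ (m - J) \<le> (1 / part_prob m J j) ^ (m - J)"
      using t two_minus_le_inverse by (intro power_mono) auto
    also have "\<dots> \<le> (1 / part_prob m J j) ^ m"
      using t by (intro power_increasing) auto
    also have "\<dots> = real J / real j" using m0 by (simp add: power_divide part_prob_power)
    also have "\<dots> \<le> real J" using j by (simp add: field_simps mult_le_cancel_left1)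
    finally have "(2 - part_prob m J j) ^ (m - J) / 2 ^ (m - J) \<le> real J / 2 ^ (m - J)"
      by (simp add: divide_right_mono)
    moreover have "1 - part_prob m J j / 2 = (2 - part_prob m J j) / 2" by (simp add: field_simps)
    ultimately show ?thesis by (simp only: power_divide)
  qed
  have "(\<Sum>v\<in>{v\<in>W. \<pi> v < J}. ?f v) \<le> (\<Sum>v\<in>{v\<in>W. \<pi> v < J}. (1 - part_prob m J (\<pi> v) / 2) ^ (m - J))"
    using inside by (intro sum_mono) auto
  also have "\<dots> = (\<Sum>j<J. \<Sum>v\<in>{v \<in> {v\<in>W. \<pi> v < J}. \<pi> v = j}. (1 - part_prob m J (\<pi> v) / 2) ^ (m - J))"
    using fW by (intro sum.group[symmetric]) auto
  also have "\<dots> = (\<Sum>j<J. real (card {v \<in> {v\<in>W. \<pi> v < J}. \<pi> v = j}) * (1 - part_prob m J j / 2) ^ (m - J))"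
    by (intro sum.cong) auto
  also have "\<dots> \<le> (\<Sum>j<J. real q * (1 - part_prob m J j / 2) ^ (m - J))"
  proof (intro sum_mono mult_right_mono)
    fix j assume j: "j \<in> {..<J}"
    have "card {v \<in> {v\<in>W. \<pi> v < J}. \<pi> v = j} \<le> card {v\<in>V. \<pi> v = j}"
      using WV V by (intro card_mono) auto
    then show "real (card {v \<in> {v\<in>W. \<pi> v < J}. \<pi> v = j}) \<le> real q"
      using card_part[of j] j by simp
    show "0 \<le> (1 - part_prob m J j / 2) ^ (m - J)"
      using part_prob_bounds[OF m0, of j J] j by simp
  qed
  \<comment> \<open>Part 0 is split off: its edges to the outside are never red, so its factor is 1
    and all its vertices may be blue pages.\<close>
  also have "\<dots> = real q * (1 + (\<Sum>j=1..<J. (1 - part_prob m J j / 2) ^ (m - J)))"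
  proof -
    have "{..<J} = insert 0 {1..<J}" using J_bounds by auto
    then show ?thesis using m0 J_bounds by (simp add: sum_distrib_left[symmetric])
  qed
  also have "\<dots> \<le> real q * (1 + (\<Sum>j=1..<J. real J / 2 ^ (m - J)))"
    using inside' by (intro mult_left_mono add_left_mono sum_mono) auto
  also have "\<dots> \<le> real q * 4"
  proof (intro mult_left_mono)
    have "real (J * J) \<le> real (3 * 2 ^ (J - 1))"
      using square_le_power[of J] J_bounds by (simp only: of_nat_le_iff)
    also have "\<dots> = 3 * 2 ^ (J - 1)" by simp
    also have "\<dots> \<le> 3 * 2 ^ (m - J)" using J m by (simp add: power_increasing)
    finally have "real J * real J / 2 ^ (m - J) \<le> 3" by (simp add: divide_le_eq)
    moreover have "(\<Sum>j=1..<J. real J / 2 ^ (m - J)) \<le> real J * real J / 2 ^ (m - J)"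
      by (simp add: divide_right_mono mult_right_mono)
    ultimately show "1 + (\<Sum>j=1..<J. real J / 2 ^ (m - J)) \<le> 4" by linarith
  qed simp
  finally have S1: "(\<Sum>v\<in>{v\<in>W. \<pi> v < J}. ?f v) \<le> 4 * real q" by simp
  have "(\<Sum>v\<in>{v\<in>W. \<pi> v = J}. ?f v) \<le> (\<Sum>v\<in>{v\<in>W. \<pi> v = J}. 6 / 2 ^ m)"
    using out by (intro sum_mono) auto
  also have "\<dots> = real (card {v\<in>W. \<pi> v = J}) * 6 / 2 ^ m" by simp
  also have "\<dots> \<le> real (card (nb w)) * 6 / 2 ^ m"
    using W[OF w(1)] fnb by (intro divide_right_mono mult_right_mono) (auto intro!: card_mono)
  also have "\<dots> \<le> (2 * real e / (real J * real q)) * 6 / 2 ^ m"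
    using degree_outside[of w] w K by (intro divide_right_mono mult_right_mono) auto
  finally have S2: "(\<Sum>v\<in>{v\<in>W. \<pi> v = J}. ?f v) \<le> 12 * real e / (2 ^ m * real J * real q)"
    by (simp add: ac_simps)
  have "(\<Sum>v\<in>W. ?f v) = (\<Sum>v\<in>{v\<in>W. \<pi> v < J}. ?f v) + (\<Sum>v\<in>{v\<in>W. \<pi> v = J}. ?f v)"
    using fW part_le by (subst sum.union_disjoint[symmetric]) (auto intro!: sum.cong simp: nat_less_le)
  then show ?thesis using S1 S2 by linarith
qed

end

section \<open>Lower bound\<close>

text \<open>Breaking ties by the order on the vertices makes \<open>rank\<close> injective, so an
  interval of \<open>q\<close> ranks holds at most \<open>q\<close> vertices. The degree bound holds
  because each of the \<open>rank v\<close> vertices before \<open>v\<close> has degree at least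
  \<open>d v\<close>, and \<open>\<pi> v * q \<le> rank v\<close>.\<close>

lemma degree_ordered_parts:
  fixes V :: "'v :: linorder set" and d :: "'v \<Rightarrow> nat"
  assumes V: "finite V" and q: "0 < q"
  obtains \<pi> :: "'v \<Rightarrow> nat" where "\<And>v. \<pi> v \<le> J" "\<And>j. j < J \<Longrightarrow> card {v\<in>V. \<pi> v = j} \<le> q"
    "\<And>v. v \<in> V \<Longrightarrow> \<pi> v * q * d v \<le> (\<Sum>w\<in>V. d w)"
proof -
  define before where "before = (\<lambda>v. {w\<in>V. d v < d w \<or> d w = d v \<and> w < v})"
  define rank where "rank = (\<lambda>v. card (before v))"
  define \<pi> where "\<pi> = (\<lambda>v. min J (rank v div q))"
  have fin: "finite (before v)" for v using V by (simp add: before_def)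
  have less: "rank v < rank w" if "v \<in> before w" for v w
    unfolding rank_def
  proof (rule psubset_card_mono[OF fin])
    have "before v \<subseteq> before w" using that by (auto simp: before_def)
    moreover have "v \<notin> before v" by (simp add: before_def)
    ultimately show "before v \<subset> before w" using that by blast
  qed
  have inj: "inj_on rank V"
  proof (rule inj_onI)
    fix v w assume vw: "v \<in> V" "w \<in> V" "rank v = rank w"
    show "v = w"
    proof (rule ccontr)
      assume "v \<noteq> w"
      then have "v \<in> before w \<or> w \<in> before v" using vw(1,2) by (auto simp: before_def)
      then show False using less[of v w] less[of w v] vw(3) by auto
    qed
  qed
  show ?thesis
  proof
    show "\<pi> v \<le> J" for v by (simp add: \<pi>_def)
    show "card {v\<in>V. \<pi> v = j} \<le> q" if "j < J" for j
    proof -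
      have "rank ` {v\<in>V. \<pi> v = j} \<subseteq> {j * q..<j * q + q}"
      proof
        fix k assume "k \<in> rank ` {v\<in>V. \<pi> v = j}"
        then have "k div q = j" using that by (auto simp: \<pi>_def min_def split: if_splits)
        then show "k \<in> {j * q..<j * q + q}"
          using q dividend_less_div_times[of q k] by auto
      qed
      moreover have "inj_on rank {v\<in>V. \<pi> v = j}" using inj by (rule inj_on_subset) auto
      ultimately have "card {v\<in>V. \<pi> v = j} \<le> card {j * q..<j * q + q}"
        by (intro card_inj_on_le) auto
      then show ?thesis by simp
    qed
    show "\<pi> v * q * d v \<le> (\<Sum>w\<in>V. d w)" for v
    proof -
      have "\<pi> v * q \<le> rank v div q * q" by (simp add: \<pi>_def)
      also have "\<dots> \<le> rank v" by simp
      finally have "\<pi> v * q * d v \<le> rank v * d v" by (rule mult_right_mono) simp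
      also have "\<dots> = (\<Sum>w\<in>before v. d v)" by (simp add: rank_def)
      also have "\<dots> \<le> (\<Sum>w\<in>before v. d w)" by (intro sum_mono) (auto simp: before_def)
      also have "\<dots> \<le> (\<Sum>w\<in>V. d w)" using V by (intro sum_mono2) (auto simp: before_def)
      finally show ?thesis .
    qed
  qed
qed

text \<open>Handshake lemma: ordered pairs of adjacent vertices are grouped by the edge they
  form.\<close>

lemma sum_degrees_le:
  assumes V: "finite V" and E: "\<And>e. e \<in> E \<Longrightarrow> e \<subseteq> V \<and> card e = 2"
  shows "(\<Sum>v\<in>V. card {w. {v, w} \<in> E}) \<le> 2 * card E"
proof -
  have fE: "finite E" using V E by (intro finite_subset[of E "Pow V"]) auto
  have nb: "{w. {v, w} \<in> E} \<subseteq> V" for v using E by blast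
  have two: "card {a, b} \<le> 2" for a b :: "'a \<times> 'a" by (cases "a = b") simp_all
  let ?ends = "\<lambda>e. {(v, w). {v, w} = e}"
  have ends: "finite (?ends e) \<and> card (?ends e) \<le> 2" if e: "e \<in> E" for e
  proof -
    obtain x y where "e = {x, y}" using E[OF e] by (meson card_2_iff)
    then have sub: "?ends e \<subseteq> {(x, y), (y, x)}" by (auto simp: doubleton_eq_iff)
    have fin: "finite (?ends e)" by (rule finite_subset[OF sub]) simp
    have "card (?ends e) \<le> card {(x, y), (y, x)}" using sub by (rule card_mono[rotated]) simp
    also have "\<dots> \<le> 2" by (rule two)
    finally show ?thesis using fin by (rule conjI[rotated])
  qed
  have "(\<Sum>v\<in>V. card {w. {v, w} \<in> E}) = card (SIGMA v:V. {w. {v, w} \<in> E})"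
    using V finite_subset[OF nb] by (intro card_SigmaI[symmetric]) auto
  also have "\<dots> \<le> card (\<Union>e\<in>E. ?ends e)"
    using fE ends by (intro card_mono) auto
  also have "\<dots> \<le> (\<Sum>e\<in>E. card (?ends e))" using fE by (rule card_UN_le)
  also have "\<dots> \<le> (\<Sum>e\<in>E. 2)" using ends by (intro sum_mono) blast
  finally show ?thesis by (simp add: mult.commute)
qed

text \<open>A union bound over candidate spines and both colours. Spine vertices have degree at
  least \<open>n\<close>, so by the handshake lemma at most \<open>m * 2 ^ m * n\<close> vertices
  qualify, which leaves at most \<open>(m * 2 ^ m * n) ^ m\<close> spines. For each spine and colour
  the expected number of pages is at most \<open>n / 2\<close>, so \<open>random_weight_tail\<close>
  bounds the failure probability by \<open>exp (n / 2) / 2 ^ n\<close>. Assumption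
  \<open>large\<close> is exactly this union bound.\<close>

lemma avoiding_coloring:
  fixes V :: "'v :: linorder set"
  assumes V: "finite V" and E: "\<And>e. e \<in> E \<Longrightarrow> e \<subseteq> V \<and> card e = 2"
    and m: "2 \<le> m" and n: "16 \<le> n"
    and small: "real (card E) \<le> real m * 2 ^ m * (real n)\<^sup>2 / 4096"
    and large: "2 * (real m * 2 ^ m * real n) ^ m * (exp (real n / 2) / 2 ^ n) < 1"
  shows "\<exists>R\<subseteq>E. \<forall>S\<in>{R, E - R}. \<forall>K P. K \<subseteq> V \<longrightarrow> card K = m \<longrightarrow> n \<le> card P \<longrightarrow>
    (\<forall>u\<in>K. \<forall>v\<in>K. u \<noteq> v \<longrightarrow> {u, v} \<in> S) \<longrightarrow> \<not> (\<forall>u\<in>K. \<forall>v\<in>P. {u, v} \<in> S)"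
proof -
  have fE: "finite E" using V E by (intro finite_subset[of E "Pow V"]) auto
  define nb where "nb = (\<lambda>v. {w. {v, w} \<in> E})"
  have nbV: "nb v \<subseteq> V" for v unfolding nb_def using E by blast
  have fnb: "finite (nb v)" for v using nbV V by (rule finite_subset)
  have degs: "(\<Sum>v\<in>V. card (nb v)) \<le> 2 * card E"
    unfolding nb_def by (rule sum_degrees_le[OF V E])
  have loop: "{v, v} \<notin> E" for v using E[of "{v, v}"] by auto
  define q where "q = n div 16"
  define J where "J = (m + 1) div 2"
  have "0 < q" "16 * q \<le> n" "n < 16 * q + 16"
    using n by (auto simp: q_def less_eq_div_iff_mult_less_eq dividend_less_times_div)
  then have q: "0 < q" "16 * q \<le> n" "n \<le> 32 * q" by linarith+
  obtain \<pi> :: "'v \<Rightarrow> nat" where \<pi>: "\<And>v. \<pi> v \<le> J" "\<And>j. j < J \<Longrightarrow> card {v\<in>V. \<pi> v = j} \<le> q"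
    "\<And>v. v \<in> V \<Longrightarrow> \<pi> v * q * card (nb v) \<le> (\<Sum>w\<in>V. card (nb w))"
    using degree_ordered_parts[OF V q(1), of J "\<lambda>v. card (nb v)"] by blast
  interpret parts: degree_partition V nb \<pi> m J q "card E"
    by unfold_locales (use V nbV m q \<pi>(1,2) le_trans[OF \<pi>(3) degs] in \<open>auto simp: J_def\<close>)
  \<comment> \<open>An edge is an unordered pair; \<open>Min\<close> and \<open>Max\<close> name its
    ends, and \<open>red_prob_commute\<close> makes their order immaterial.\<close>
  define p where "p = (\<lambda>e. red_prob m J (\<pi> (Min e)) (\<pi> (Max e)))"
  have p_pair: "p {u, v} = red_prob m J (\<pi> u) (\<pi> v)" if "u \<noteq> v" for u v
    using that by (cases u v rule: linorder_cases) (auto simp: p_def red_prob_commute)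
  have p01: "0 \<le> p e \<and> p e \<le> 1" for e using red_prob_bounds m \<pi>(1) by (simp add: p_def)
  have nn: "0 \<le> random_weight p E R" if "R \<subseteq> E" for R
    using p01 that by (intro random_weight_nonneg) auto
  define \<delta> where "\<delta> = exp (real n / 2) / 2 ^ n"
  \<comment> \<open>Origin of the constant 4096: with \<open>J \<ge> m / 2\<close> and
    \<open>q \<ge> n / 32\<close>, the inequality needs
    \<open>2 * card E \<le> m / 2 * 2 ^ m * (n / 32)\<^sup>2\<close>, and
    \<open>2 * 2 * 32 * 32 = 4096\<close>.\<close>
  have ratio: "2 * real (card E) / (2 ^ m * real J * real q) \<le> real n / 32"
  proof -
    have "real m / 2 \<le> real J" unfolding J_def by linarith
    moreover have "real n / 32 \<le> real q" using q(3) by linarith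
    ultimately have "real m / 2 * (real n / 32) \<le> real J * real q" by (intro mult_mono) auto
    then have "2 ^ m * (real m / 2 * (real n / 32)) \<le> 2 ^ m * (real J * real q)"
      by (intro mult_left_mono) auto
    then have "real n / 32 * (2 ^ m * (real m / 2 * (real n / 32)))
        \<le> real n / 32 * (2 ^ m * (real J * real q))"
      by (intro mult_left_mono) auto
    moreover have "2 * real (card E) \<le> real n / 32 * (2 ^ m * (real m / 2 * (real n / 32)))"
      using small by (simp add: power2_eq_square ac_simps)
    moreover have "0 < 2 ^ m * real J * real q" using parts.J_bounds q by simp
    ultimately show ?thesis by (simp add: divide_le_eq ac_simps)
  qed
  define common where "common = (\<lambda>K. {v\<in>V. \<forall>u\<in>K. {u, v} \<in> E})"
  define T where "T = (\<lambda>(K :: 'v set) v. (\<lambda>u. {u, v}) ` K)"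
  define \<K> where "\<K> = {K. K \<subseteq> {v\<in>V. n \<le> card (nb v)} \<and> card K = m}"
  define bad where "bad = (\<lambda>K S. (\<forall>u\<in>K. \<forall>v\<in>K. u \<noteq> v \<longrightarrow> {u, v} \<in> S) \<and>
    n \<le> card {v\<in>common K. T K v \<subseteq> S})"
  have KV: "K \<subseteq> V" "card K = m" "finite K" "K \<noteq> {}" if "K \<in> \<K>" for K
  proof -
    show "K \<subseteq> V" "card K = m" using that by (auto simp: \<K>_def)
    then show "finite K" "K \<noteq> {}" using V m finite_subset by auto
  qed
  have common: "finite (common K)" "\<And>u. u \<in> K \<Longrightarrow> common K \<subseteq> nb u" for K
    using V by (auto simp: common_def nb_def)
  have notin: "v \<notin> K" if "v \<in> common K" for v K using that loop by (auto simp: common_def)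
  have TE: "T K v \<subseteq> E" if "v \<in> common K" for v K using that by (auto simp: T_def common_def)
  have Tdisj: "T K v \<inter> T K w = {}" if "v \<in> common K" "w \<in> common K" "v \<noteq> w" for K v w
    using that(3) notin[OF that(1)] notin[OF that(2)] by (auto simp: T_def doubleton_eq_iff)
  have prodT: "(\<Prod>e\<in>T K v. f (p e)) = (\<Prod>u\<in>K. f (red_prob m J (\<pi> u) (\<pi> v)))"
    if "v \<in> common K" for K v and f :: "real \<Rightarrow> real"
  proof -
    have "inj_on (\<lambda>u. {u, v}) K" by (auto simp: inj_on_def doubleton_eq_iff)
    then have "(\<Prod>e\<in>T K v. f (p e)) = (\<Prod>u\<in>K. f (p {u, v}))"
      unfolding T_def by (simp add: prod.reindex)
    also have "\<dots> = (\<Prod>u\<in>K. f (red_prob m J (\<pi> u) (\<pi> v)))"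
    proof (rule prod.cong)
      fix u assume "u \<in> K"
      then have "u \<noteq> v" using notin[OF that] by blast
      then show "f (p {u, v}) = f (red_prob m J (\<pi> u) (\<pi> v))" by (simp add: p_pair)
    qed simp
    finally show ?thesis .
  qed
  have red: "(\<Sum>R | R \<subseteq> E \<and> bad K R. random_weight p E R) \<le> \<delta>" if K: "K \<in> \<K>" for K
  \<comment> \<open>If some pair in \<open>K\<close> is never red, every \<open>R\<close> in the sum
    has weight 0. Otherwise \<open>red_pages\<close> applies, the negated case condition being its
    assumption \<open>mono\<close>.\<close>
  proof (cases "\<exists>u\<in>K. \<exists>v\<in>K. u \<noteq> v \<and> red_prob m J (\<pi> u) (\<pi> v) = 0")
    case True
    then obtain u v where uv: "u \<in> K" "v \<in> K" "u \<noteq> v" "p {u, v} = 0" using p_pair by metis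
    have "random_weight p E R = 0" if "R \<subseteq> E" "bad K R" for R
    proof -
      have "{u, v} \<in> R" using that(2) uv by (simp add: bad_def)
      then have "(\<Prod>e\<in>R. p e) = 0" using uv(4) finite_subset[OF that(1) fE] by (intro prod_zero) auto
      then show ?thesis by (simp add: random_weight_def)
    qed
    then have "(\<Sum>R | R \<subseteq> E \<and> bad K R. random_weight p E R) = 0" by (intro sum.neutral) auto
    then show ?thesis by (simp add: \<delta>_def)
  next
    case False
    have "(\<Sum>R | R \<subseteq> E \<and> bad K R. random_weight p E R)
        \<le> (\<Sum>R | R \<subseteq> E \<and> n \<le> card {v\<in>common K. T K v \<subseteq> R}. random_weight p E R)"
      using fE nn by (intro sum_mono2) (auto simp: bad_def)
    also have "\<dots> \<le> exp (\<Sum>v\<in>common K. \<Prod>e\<in>T K v. p e) / 2 ^ n"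
      using fE p01 common(1) TE Tdisj by (intro random_weight_tail) auto
    also have "(\<Sum>v\<in>common K. \<Prod>e\<in>T K v. p e)
        = (\<Sum>v\<in>common K. \<Prod>u\<in>K. red_prob m J (\<pi> u) (\<pi> v))"
      using prodT[where f = "\<lambda>x. x"] by (intro sum.cong) auto
    also have "\<dots> \<le> real q + 2 * real (card E) / (2 ^ m * real J * real q)"
      using parts.red_pages[OF KV(1,2)[OF K] common(2)] False by blast
    also have "\<dots> \<le> real n / 2" using ratio q(2) by linarith
    finally show ?thesis by (simp add: \<delta>_def divide_right_mono)
  qed
  have blue: "(\<Sum>R | R \<subseteq> E \<and> bad K (E - R). random_weight p E R) \<le> \<delta>" if K: "K \<in> \<K>" for K
  proof (cases "\<exists>u\<in>K. \<exists>v\<in>K. u \<noteq> v \<and> red_prob m J (\<pi> u) (\<pi> v) = 1")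
    case True
    then obtain u v where uv: "u \<in> K" "v \<in> K" "u \<noteq> v" "p {u, v} = 1" using p_pair by metis
    have "random_weight p E R = 0" if "R \<subseteq> E" "bad K (E - R)" for R
    proof -
      have "{u, v} \<in> E - R" using that(2) uv by (simp add: bad_def)
      then have "(\<Prod>e\<in>E - R. 1 - p e) = 0" using uv(4) fE by (intro prod_zero) auto
      then show ?thesis by (simp add: random_weight_def)
    qed
    then have "(\<Sum>R | R \<subseteq> E \<and> bad K (E - R). random_weight p E R) = 0" by (intro sum.neutral) auto
    then show ?thesis by (simp add: \<delta>_def)
  next
    case False
    have "(\<Sum>R | R \<subseteq> E \<and> bad K (E - R). random_weight p E R)
        \<le> (\<Sum>R | R \<subseteq> E \<and> n \<le> card {v\<in>common K. T K v \<subseteq> E - R}. random_weight p E R)"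
      using fE nn by (intro sum_mono2) (auto simp: bad_def)
    also have "\<dots> \<le> exp (\<Sum>v\<in>common K. \<Prod>e\<in>T K v. 1 - p e) / 2 ^ n"
      using fE p01 common(1) TE Tdisj by (intro random_weight_tail_compl) auto
    also have "(\<Sum>v\<in>common K. \<Prod>e\<in>T K v. 1 - p e)
        = (\<Sum>v\<in>common K. \<Prod>u\<in>K. 1 - red_prob m J (\<pi> u) (\<pi> v))"
      using prodT[where f = "\<lambda>x. 1 - x"] by (intro sum.cong) auto
    also have "\<dots> \<le> 4 * real q + 12 * real (card E) / (2 ^ m * real J * real q)"
      using parts.blue_pages[OF KV(1,2)[OF K] common(2)] False by blast
    \<comment> \<open>Here \<open>4 * q \<le> n / 4\<close>, and the second term is six times the
      one in \<open>ratio\<close>, at most \<open>3 * n / 16\<close>.\<close>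
    also have "\<dots> \<le> real n / 2" using ratio q(2) by linarith
    finally show ?thesis by (simp add: \<delta>_def divide_right_mono)
  qed
  have f\<K>: "finite \<K>"
    using V by (intro finite_subset[of \<K> "Pow V"]) (auto simp: \<K>_def)
  have c\<K>: "real (card \<K>) \<le> (real m * 2 ^ m * real n) ^ m"
  proof -
    define H where "H = {v\<in>V. n \<le> card (nb v)}"
    have fH: "finite H" using V by (simp add: H_def)
    have "card H * n = (\<Sum>v\<in>H. n)" by simp
    also have "\<dots> \<le> (\<Sum>v\<in>H. card (nb v))" by (intro sum_mono) (simp add: H_def)
    also have "\<dots> \<le> (\<Sum>v\<in>V. card (nb v))" using V by (intro sum_mono2) (auto simp: H_def)
    finally have "card H * n \<le> 2 * card E" using degs by linarith
    then have "real (card H * n) \<le> real (2 * card E)" by (simp only: of_nat_le_iff)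
    then have "real (card H) * real n \<le> (real m * 2 ^ m * real n) * real n"
      using small by (simp add: power2_eq_square)
    then have H: "real (card H) \<le> real m * 2 ^ m * real n" using n by simp
    have "card \<K> = card H choose m" unfolding \<K>_def H_def[symmetric] using fH by (rule n_subsets)
    also have "\<dots> \<le> (card H choose m) * fact m" by simp
    also have "\<dots> \<le> card H ^ m" by (rule binomial_fact_pow)
    finally have "real (card \<K>) \<le> real (card H) ^ m" by (metis of_nat_le_iff of_nat_power)
    also have "\<dots> \<le> (real m * 2 ^ m * real n) ^ m" using H by (intro power_mono) auto
    finally show ?thesis .
  qed
  have "\<exists>R\<subseteq>E. \<forall>K\<in>\<K>. \<not> bad K R \<and> \<not> bad K (E - R)"
  proof (rule ccontr)
    assume *: "\<not> ?thesis"
    have "1 = (\<Sum>R\<in>Pow E. random_weight p E R)" using fE by (simp add: sum_random_weight)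
    also have "\<dots> \<le> (\<Sum>R\<in>Pow E. \<Sum>K\<in>\<K>. (if bad K R then random_weight p E R else 0) +
        (if bad K (E - R) then random_weight p E R else 0))"
    proof (rule sum_mono)
      fix R assume R: "R \<in> Pow E"
      then obtain K where K: "K \<in> \<K>" "bad K R \<or> bad K (E - R)" using * by blast
      let ?g = "\<lambda>K. (if bad K R then random_weight p E R else 0) +
        (if bad K (E - R) then random_weight p E R else 0)"
      have "random_weight p E R \<le> ?g K" using K(2) nn R by auto
      also have "\<dots> \<le> (\<Sum>K\<in>\<K>. ?g K)" using K(1) f\<K> nn R by (intro member_le_sum) auto
      finally show "random_weight p E R \<le> (\<Sum>K\<in>\<K>. ?g K)" .
    qed
    also have "\<dots> = (\<Sum>K\<in>\<K>. (\<Sum>R\<in>Pow E. if bad K R then random_weight p E R else 0) +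
        (\<Sum>R\<in>Pow E. if bad K (E - R) then random_weight p E R else 0))"
      by (subst sum.swap) (simp add: sum.distrib)
    also have "\<dots> = (\<Sum>K\<in>\<K>. (\<Sum>R | R \<subseteq> E \<and> bad K R. random_weight p E R) +
        (\<Sum>R | R \<subseteq> E \<and> bad K (E - R). random_weight p E R))"
    proof -
      have "Pow E \<inter> {R. bad K R} = {R. R \<subseteq> E \<and> bad K R}"
        "Pow E \<inter> {R. bad K (E - R)} = {R. R \<subseteq> E \<and> bad K (E - R)}" for K by auto
      then show ?thesis using fE by (simp add: sum.If_cases)
    qed
    also have "\<dots> \<le> (\<Sum>K\<in>\<K>. \<delta> + \<delta>)" using red blue by (intro sum_mono add_mono)
    also have "\<dots> = 2 * real (card \<K>) * \<delta>" by simp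
    also have "\<dots> \<le> 2 * (real m * 2 ^ m * real n) ^ m * \<delta>"
      using c\<K> by (intro mult_right_mono) (auto simp: \<delta>_def)
    also have "\<dots> < 1" using large by (simp add: \<delta>_def)
    finally show False by simp
  qed
  then obtain R where R: "R \<subseteq> E" "\<And>K. K \<in> \<K> \<Longrightarrow> \<not> bad K R \<and> \<not> bad K (E - R)" by blast
  have no_book: "False" if S: "S \<in> {R, E - R}" and K: "K \<subseteq> V" "card K = m" and P: "n \<le> card P"
    and KK: "\<forall>u\<in>K. \<forall>v\<in>K. u \<noteq> v \<longrightarrow> {u, v} \<in> S" and KP: "\<forall>u\<in>K. \<forall>v\<in>P. {u, v} \<in> S" for S K P
  proof -
    have SE: "S \<subseteq> E" using S R(1) by auto
    have "K \<noteq> {}" using K(2) m by auto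
    have Pnb: "P \<subseteq> nb u" if "u \<in> K" for u using KP SE that by (auto simp: nb_def)
    then have "P \<subseteq> V" using \<open>K \<noteq> {}\<close> nbV by blast
    have "n \<le> card (nb u)" if "u \<in> K" for u
      using P card_mono[OF fnb Pnb[OF that]] by simp
    then have "K \<in> \<K>" using K by (auto simp: \<K>_def)
    moreover have "bad K S"
    proof -
      have "P \<subseteq> {v\<in>common K. T K v \<subseteq> S}"
        using \<open>P \<subseteq> V\<close> KP SE by (auto simp: common_def T_def)
      then have "card P \<le> card {v\<in>common K. T K v \<subseteq> S}" using common(1) by (intro card_mono) auto
      then show ?thesis using KK P by (simp add: bad_def)
    qed
    ultimately show False using R(2) S by auto
  qed
  show ?thesis
  proof (intro exI[of _ R] conjI R(1) ballI allI impI notI)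
    fix S K P
    assume "S \<in> {R, E - R}" "K \<subseteq> V" "card K = m" "n \<le> card P"
      "\<forall>u\<in>K. \<forall>v\<in>K. u \<noteq> v \<longrightarrow> {u, v} \<in> S" "\<forall>u\<in>K. \<forall>v\<in>P. {u, v} \<in> S"
    then show False by (rule no_book)
  qed
qed

lemma book_copy_sets:
  assumes "eo_copy C (book m n) F"
  obtains K P where "K \<subseteq> verts F" "card K = m" "card P = n"
    "\<forall>u\<in>K. \<forall>v\<in>K. u \<noteq> v \<longrightarrow> {u, v} \<in> edges C" "\<forall>u\<in>K. \<forall>v\<in>P. {u, v} \<in> edges C"
proof -
  have CF: "verts C \<subseteq> verts F" "\<And>e. e \<in> edges C \<Longrightarrow> e \<subseteq> verts C"
    using assms by (auto simp: eo_copy_def eo_subgraph_def edge_ordered_graph_def)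
  obtain f where f: "bij_betw f (verts C) (verts (book m n))"
    "edges (book m n) = (\<lambda>e. f ` e) ` edges C"
    using assms by (auto simp: eo_copy_def eo_isomorphic_def)
  \<comment> \<open>\<open>eo_isomorphic\<close> provides a map from the copy to the book; its
    inverse locates spine and pages in the host.\<close>
  define g where "g = inv_into (verts C) f"
  have g: "bij_betw g (verts (book m n)) (verts C)"
    unfolding g_def by (rule bij_betw_inv_into[OF f(1)])
  have edge: "{g x, g y} \<in> edges C" if xy: "{x, y} \<in> edges (book m n)" for x y
  proof -
    obtain e where e: "e \<in> edges C" "{x, y} = f ` e" using f(2) xy by blast
    have "g ` f ` e = e"
      unfolding g_def using f(1) CF(2)[OF e(1)] by (intro inv_into_image_cancel) (auto simp: bij_betw_def)
    then have "g ` {x, y} \<in> edges C" unfolding e(2) using e(1) by simp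
    then show ?thesis by simp
  qed
  have inj: "inj_on g (verts (book m n))" and ran: "g ` verts (book m n) = verts C"
    using g by (auto simp: bij_betw_def)
  have verts: "Spine ` {1..m} \<subseteq> verts (book m n)" "Page ` {1..n} \<subseteq> verts (book m n)"
    by (auto simp: book_def)
  show ?thesis
  proof
    show "g ` Spine ` {1..m} \<subseteq> verts F" using verts ran CF by blast
    have "card (g ` Spine ` {1..m}) = card (Spine ` {1..m})"
      using inj verts by (meson card_image inj_on_subset)
    also have "\<dots> = m" by (simp add: card_image inj_on_def)
    finally show "card (g ` Spine ` {1..m}) = m" .
    have "card (g ` Page ` {1..n}) = card (Page ` {1..n})"
      using inj verts by (meson card_image inj_on_subset)
    also have "\<dots> = n" by (simp add: card_image inj_on_def)
    finally show "card (g ` Page ` {1..n}) = n" .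
    show "\<forall>u\<in>g ` Spine ` {1..m}. \<forall>v\<in>g ` Spine ` {1..m}. u \<noteq> v \<longrightarrow> {u, v} \<in> edges C"
    proof (intro ballI impI)
      fix u v assume "u \<in> g ` Spine ` {1..m}" "v \<in> g ` Spine ` {1..m}" "u \<noteq> v"
      then obtain i j where ij: "i \<in> {1..m}" "j \<in> {1..m}" "u = g (Spine i)" "v = g (Spine j)"
        by blast
      then have "i \<noteq> j" using \<open>u \<noteq> v\<close> by auto
      have "{Spine i, Spine j} \<in> spine_edges m"
      proof (cases "i < j")
        case True
        then show ?thesis using ij(1,2) unfolding spine_edges_def by auto
      next
        case False
        then have "j < i" using \<open>i \<noteq> j\<close> by simp
        then have "{Spine j, Spine i} \<in> spine_edges m" using ij(1,2) unfolding spine_edges_def by auto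
        then show ?thesis by (simp add: insert_commute)
      qed
      then show "{u, v} \<in> edges C" using edge ij(3,4) by (simp add: book_def)
    qed
    show "\<forall>u\<in>g ` Spine ` {1..m}. \<forall>v\<in>g ` Page ` {1..n}. {u, v} \<in> edges C"
    proof (intro ballI)
      fix u v assume "u \<in> g ` Spine ` {1..m}" "v \<in> g ` Page ` {1..n}"
      then obtain i j where ij: "i \<in> {1..m}" "j \<in> {1..n}" "u = g (Spine i)" "v = g (Page j)" by auto
      then have "{Page j, Spine i} \<in> edges (book m n)" by (auto simp: book_def page_edges_def)
      from edge[OF this] show "{u, v} \<in> edges C" using ij(3,4) by (simp add: insert_commute)
    qed
  qed
qed

text \<open>Since \<open>exp 1 < 4\<close>, the ratio \<open>r = exp (1 / 2) / 2\<close> is below 1.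
  With \<open>\<rho>\<close> its \<open>m\<close>-th root, the expression is a constant multiple of
  \<open>(n * \<rho> ^ n) ^ m\<close>, and \<open>n * \<rho> ^ n\<close> tends to 0.\<close>

lemma eventually_union_bound:
  assumes "0 < m"
  shows "\<forall>\<^sub>F n in sequentially. 2 * (real m * 2 ^ m * real n) ^ m * (exp (real n / 2) / 2 ^ n) < 1"
proof -
  define r where "r = exp (1 / 2 :: real) / 2"
  define \<rho> where "\<rho> = root m r"
  have "exp (1 / 2 :: real) < 2"
  proof -
    have "exp (1 / 2 :: real) ^ 2 = exp 1" by (simp add: exp_of_nat_mult[symmetric])
    also have "\<dots> < 2 ^ 2" using exp_le by simp
    finally show ?thesis by (rule power_less_imp_less_base) simp
  qed
  then have r: "0 < r" "r < 1" by (auto simp: r_def)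
  then have \<rho>: "0 < \<rho>" "\<rho> < 1" "\<rho> ^ m = r" using assms by (auto simp: \<rho>_def)
  have "(\<lambda>n. real n * \<rho> ^ n) \<longlonglongrightarrow> 0" using \<rho> by (intro powser_times_n_limit_0) simp
  then have "(\<lambda>n. 2 * (real m * 2 ^ m) ^ m * (real n * \<rho> ^ n) ^ m) \<longlonglongrightarrow> 2 * (real m * 2 ^ m) ^ m * 0 ^ m"
    by (intro tendsto_intros)
  moreover have "(0 :: real) ^ m = 0" using assms by simp
  ultimately have "(\<lambda>n. 2 * (real m * 2 ^ m) ^ m * (real n * \<rho> ^ n) ^ m) \<longlonglongrightarrow> 0"
    by (simp only: mult_zero_right)
  moreover have "2 * (real m * 2 ^ m) ^ m * (real n * \<rho> ^ n) ^ m
      = 2 * (real m * 2 ^ m * real n) ^ m * (exp (real n / 2) / 2 ^ n)" for n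
  proof -
    have "(\<rho> ^ n) ^ m = r ^ n" using \<rho>(3) by (metis power_mult mult.commute)
    also have "\<dots> = exp (real n / 2) / 2 ^ n"
      by (simp add: r_def power_divide exp_of_nat_mult[symmetric])
    finally show ?thesis by (simp add: power_mult_distrib)
  qed
  ultimately have "(\<lambda>n. 2 * (real m * 2 ^ m * real n) ^ m * (exp (real n / 2) / 2 ^ n)) \<longlonglongrightarrow> 0" by simp
  then show ?thesis by (rule order_tendstoD) simp
qed

lemma size_eo_ramsey_book_lower:
  assumes m: "2 \<le> m"
  shows "\<forall>\<^sub>F n in sequentially.
    ereal (1 / 4096 * (real m * 2 ^ m * (real n)\<^sup>2)) \<le> ereal_of_enat (size_eo_ramsey (book m n))"
  using eventually_union_bound[OF less_le_trans[OF pos2 m]] eventually_ge_at_top[of 16]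
proof eventually_elim
  case (elim n)
  let ?S = "{enat (card (edges F)) | F :: nat eo_graph.
    edge_ordered_graph F \<and> eo_arrows F (book m n) (book m n)}"
  have many: "real m * 2 ^ m * (real n)\<^sup>2 / 4096 \<le> real (card (edges F))"
    if F: "edge_ordered_graph F" "eo_arrows F (book m n) (book m n)" for F :: "nat eo_graph"
  proof (rule ccontr)
    assume "\<not> ?thesis"
    then have "real (card (edges F)) \<le> real m * 2 ^ m * (real n)\<^sup>2 / 4096" by simp
    from avoiding_coloring[OF _ _ m elim(2) this elim(1), of "verts F"] F(1)
    obtain R where R: "R \<subseteq> edges F" "\<forall>S\<in>{R, edges F - R}. \<forall>K P. K \<subseteq> verts F \<longrightarrow> card K = m \<longrightarrow>
      n \<le> card P \<longrightarrow> (\<forall>u\<in>K. \<forall>v\<in>K. u \<noteq> v \<longrightarrow> {u, v} \<in> S) \<longrightarrow> \<not> (\<forall>u\<in>K. \<forall>v\<in>P. {u, v} \<in> S)"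
      by (auto simp: edge_ordered_graph_def)
    obtain C S where C: "eo_copy C (book m n) F" "S \<in> {R, edges F - R}" "edges C \<subseteq> S"
      using F(2) R(1) unfolding eo_arrows_def by blast
    from C(1) obtain K P where "K \<subseteq> verts F" "card K = m" "card P = n"
      "\<forall>u\<in>K. \<forall>v\<in>K. u \<noteq> v \<longrightarrow> {u, v} \<in> edges C" "\<forall>u\<in>K. \<forall>v\<in>P. {u, v} \<in> edges C"
      by (rule book_copy_sets)
    moreover from this C(3) have "\<forall>u\<in>K. \<forall>v\<in>K. u \<noteq> v \<longrightarrow> {u, v} \<in> S" "\<forall>u\<in>K. \<forall>v\<in>P. {u, v} \<in> S"
      by blast+
    ultimately show False using R(2) C(2) by (metis order_refl)
  qed
  have "size_eo_ramsey (book m n) = Inf ?S"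
    by (simp add: size_eo_ramsey_def size_eo_ramsey2_def)
  show ?case
  proof (cases "?S = {}")
    \<comment> \<open>Without any host the infimum is \<open>\<infinity>\<close> and the bound is
      trivial; otherwise the infimum is attained, as \<open>enat\<close> is well-ordered.\<close>
    case True
    then show ?thesis
      unfolding \<open>size_eo_ramsey (book m n) = Inf ?S\<close> True by (simp add: top_enat_def)
  next
    case False
    then have "Inf ?S \<in> ?S" using wellorder_InfI by (metis (no_types, lifting) ex_in_conv)
    then obtain F :: "nat eo_graph" where "Inf ?S = enat (card (edges F))" "edge_ordered_graph F"
      "eo_arrows F (book m n) (book m n)" by blast
    then show ?thesis
      unfolding \<open>size_eo_ramsey (book m n) = Inf ?S\<close> using many[of F] by simp
  qed
qed

section \<open>Cliques of one colour joined in the other\<close>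

definition rel_clique :: "('a \<Rightarrow> 'a \<Rightarrow> bool) \<Rightarrow> 'a set \<Rightarrow> bool" where
  "rel_clique r K \<longleftrightarrow> (\<forall>a\<in>K. \<forall>b\<in>K. a \<noteq> b \<longrightarrow> r a b)"

lemma rel_clique_mono: "rel_clique r K \<Longrightarrow> L \<subseteq> K \<Longrightarrow> rel_clique r L"
  by (auto simp: rel_clique_def)

text \<open>Asking for cliques in every half, not only in \<open>U\<close>, lets the greedy
  construction discard up to half of a block as unsuitable and still find a clique in the
  rest.\<close>

definition half_rich :: "('a \<Rightarrow> 'a \<Rightarrow> bool) \<Rightarrow> nat \<Rightarrow> 'a set \<Rightarrow> bool" where
  "half_rich r x U \<longleftrightarrow> finite U \<and>
     (\<forall>W\<subseteq>U. card U \<le> 2 * card W \<longrightarrow> (\<exists>Z\<subseteq>W. card Z = x \<and> rel_clique r Z))"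

lemma half_rich_mono:
  assumes "half_rich r x U" "y \<le> x"
  shows "half_rich r y U"
  unfolding half_rich_def
proof (intro conjI allI impI)
  fix W assume "W \<subseteq> U" "card U \<le> 2 * card W"
  then obtain Z where Z: "Z \<subseteq> W" "card Z = x" "rel_clique r Z"
    using assms(1) unfolding half_rich_def by blast
  obtain Y where "Y \<subseteq> Z" "card Y = y"
    using obtain_subset_with_card_n[of y Z] Z(2) assms(2) by blast
  then show "\<exists>Y\<subseteq>W. card Y = y \<and> rel_clique r Y"
    using Z rel_clique_mono[of r Z Y] by blast
qed (use assms in \<open>simp add: half_rich_def\<close>)

lemma split_into_pieces:
  assumes "card A = k * y"
  obtains P where "\<And>i. i < k \<Longrightarrow> P i \<subseteq> A" "\<And>i. i < k \<Longrightarrow> card (P i) = y"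
    "\<And>i j. i < k \<Longrightarrow> j < k \<Longrightarrow> i \<noteq> j \<Longrightarrow> P i \<inter> P j = {}"
  using assms
proof (induction k arbitrary: A thesis)
  case (Suc k)
  obtain B where B: "B \<subseteq> A" "card B = y"
    using obtain_subset_with_card_n[of y A] Suc.prems(2) by auto
  show ?case
  proof (cases "finite A")
    case True
    then have "card (A - B) = k * y" using B Suc.prems(2) by (simp add: card_Diff_subset finite_subset)
    then obtain P where P: "\<And>i. i < k \<Longrightarrow> P i \<subseteq> A - B" "\<And>i. i < k \<Longrightarrow> card (P i) = y"
      "\<And>i j. i < k \<Longrightarrow> j < k \<Longrightarrow> i \<noteq> j \<Longrightarrow> P i \<inter> P j = {}"
      using Suc.IH[of "A - B"] by blast
    show ?thesis
    proof (rule Suc.prems(1)[of "P(k := B)"])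
      fix i assume "i < Suc k"
      then show "(P(k := B)) i \<subseteq> A" "card ((P(k := B)) i) = y"
        using P(1,2)[of i] B by (auto simp: less_Suc_eq)
    next
      fix i j assume "i < Suc k" "j < Suc k" "i \<noteq> j"
      then show "(P(k := B)) i \<inter> (P(k := B)) j = {}"
        using P(3)[of i j] P(1)[of i] P(1)[of j] by (auto simp: less_Suc_eq)
    qed
  next
    \<comment> \<open>An infinite \<open>A\<close> has cardinality 0, which forces
      \<open>y = 0\<close> and admits empty pieces.\<close>
    case False
    then have "y = 0" using Suc.prems(2) by auto
    then show ?thesis using Suc.prems(1)[of "\<lambda>_. {}"] by simp
  qed
qed simp

text \<open>Double counting: a vertex with fewer than \<open>y\<close> blue neighbours in \<open>Q i\<close> has one in fewer than \<open>y\<close>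
  of the \<open>2 * y\<close> disjoint pieces.\<close>

lemma common_piece:
  assumes y: "0 < y" and X: "finite X"
    and P: "\<And>i k. i \<in> I \<Longrightarrow> k < 2 * y \<Longrightarrow> P i k \<subseteq> Q i" "\<And>i. i \<in> I \<Longrightarrow> finite (Q i)"
    and disj: "\<And>i k l. i \<in> I \<Longrightarrow> k < 2 * y \<Longrightarrow> l < 2 * y \<Longrightarrow> k \<noteq> l \<Longrightarrow> P i k \<inter> P i l = {}"
    and few: "\<And>v. v \<in> X \<Longrightarrow> \<exists>i\<in>I. card {a\<in>Q i. \<not> r a v} < y"
  obtains k where "k < 2 * y" "card X \<le> 2 * card {v\<in>X. \<exists>i\<in>I. \<forall>a\<in>P i k. r a v}"
proof -
  let ?G = "\<lambda>v k. \<exists>i\<in>I. \<forall>a\<in>P i k. r a v"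
  have ge: "y \<le> card {k\<in>{..<2 * y}. ?G v k}" if v: "v \<in> X" for v
  proof -
    obtain i where i: "i \<in> I" "card {a\<in>Q i. \<not> r a v} < y" using few[OF v] by blast
    define B where "B = {k\<in>{..<2 * y}. \<not> (\<forall>a\<in>P i k. r a v)}"
    have "\<forall>k\<in>B. \<exists>a. a \<in> P i k \<and> \<not> r a v" by (auto simp: B_def)
    then obtain h where h: "\<And>k. k \<in> B \<Longrightarrow> h k \<in> P i k \<and> \<not> r (h k) v" by metis
    have "inj_on h B"
    proof (rule inj_onI)
      fix k l assume "k \<in> B" "l \<in> B" "h k = h l"
      then show "k = l" using h[of k] h[of l] disj[OF i(1), of k l] by (auto simp: B_def)
    qed
    moreover have "h ` B \<subseteq> {a\<in>Q i. \<not> r a v}" using h P(1)[OF i(1)] by (fastforce simp: B_def)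
    ultimately have "card B \<le> card {a\<in>Q i. \<not> r a v}"
      using P(2)[OF i(1)] by (intro card_inj_on_le) auto
    then have "card B < y" using i(2) by simp
    moreover have "card ({..<2 * y} - B) = 2 * y - card B"
      by (subst card_Diff_subset) (auto simp: B_def)
    moreover have "card ({..<2 * y} - B) \<le> card {k\<in>{..<2 * y}. ?G v k}"
      using i(1) by (intro card_mono) (auto simp: B_def)
    ultimately show ?thesis by simp
  qed
  have "y * card X \<le> (\<Sum>v\<in>X. card {k\<in>{..<2 * y}. ?G v k})"
    using sum_mono[of X "\<lambda>_. y", OF ge] by (simp add: mult.commute)
  also have "\<dots> = (\<Sum>k<2 * y. card {v\<in>X. ?G v k})"
    using X by (intro sum_multicount_gen) auto
  finally have *: "y * card X \<le> (\<Sum>k<2 * y. card {v\<in>X. ?G v k})" .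
  have "\<exists>k<2 * y. card X \<le> 2 * card {v\<in>X. ?G v k}"
  proof (rule ccontr)
    assume "\<not> ?thesis"
    then have "2 * card {v\<in>X. ?G v k} < card X" if "k < 2 * y" for k using that by (simp add: not_le)
    then have "(\<Sum>k<2 * y. 2 * card {v\<in>X. ?G v k}) < (\<Sum>k<2 * y. card X)"
      using y by (intro sum_strict_mono) (auto simp: lessThan_empty_iff)
    then show False using * by (simp add: sum_distrib_left[symmetric])
  qed
  then show ?thesis using that by blast
qed

text \<open>In the application \<open>f v\<close> is the set of vertices in the earlier cliques to
  which \<open>v\<close> is joined in blue, so the members of one fibre see all earlier cliques
  alike.\<close>

lemma pigeonhole_fibre:
  assumes "finite Z" "f ` Z \<subseteq> Pow A" "finite A" "card A \<le> a" "card Z = y * 2 ^ a"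
  obtains N where "N \<subseteq> A" "y \<le> card {v\<in>Z. f v = N}"
proof -
  have "\<exists>N\<in>Pow A. card (f -` {N} \<inter> Z) * card (Pow A) \<ge> card Z"
    using assms by (intro pigeonhole_card) auto
  then obtain N where N: "N \<subseteq> A" "y * 2 ^ a \<le> card (f -` {N} \<inter> Z) * 2 ^ card A"
    using assms by (auto simp: card_Pow)
  note N(2)
  also have "card (f -` {N} \<inter> Z) * 2 ^ card A \<le> card (f -` {N} \<inter> Z) * 2 ^ a"
    using assms by (intro mult_left_mono power_increasing) auto
  finally have "y \<le> card (f -` {N} \<inter> Z)" by simp
  moreover have "f -` {N} \<inter> Z = {v\<in>Z. f v = N}" by auto
  ultimately show ?thesis using that N by simp
qed

definition clique_system :: "('a \<Rightarrow> 'a \<Rightarrow> bool) \<Rightarrow> nat \<Rightarrow> nat set \<Rightarrow> (nat \<Rightarrow> 'a set) \<Rightarrow> (nat \<Rightarrow> 'a set) \<Rightarrow> bool"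
  where "clique_system r y I Q U \<longleftrightarrow>
    (\<forall>i\<in>I. Q i \<subseteq> U i \<and> card (Q i) = y \<and> rel_clique r (Q i)) \<and>
    (\<forall>i\<in>I. \<forall>j\<in>I. i \<noteq> j \<longrightarrow> (\<forall>a\<in>Q i. \<forall>b\<in>Q j. \<not> r a b))"

lemma clique_system_shrink:
  assumes "clique_system r x I Q U" "\<And>i. i \<in> I \<Longrightarrow> Q' i \<subseteq> Q i" "\<And>i. i \<in> I \<Longrightarrow> card (Q' i) = y"
  shows "clique_system r y I Q' U"
  unfolding clique_system_def
proof (intro conjI ballI impI)
  fix i assume i: "i \<in> I"
  show "Q' i \<subseteq> U i" "card (Q' i) = y" "rel_clique r (Q' i)"
    using assms i rel_clique_mono[OF _ assms(2)[OF i]] unfolding clique_system_def by blast+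
next
  fix i j a b assume "i \<in> I" "j \<in> I" "i \<noteq> j" "a \<in> Q' i" "b \<in> Q' j"
  then show "\<not> r a b" using assms(1,2) unfolding clique_system_def by blast
qed

text \<open>The set of vertices joined entirely in red to some clique of the system only grows when
  cliques shrink. This is what makes the blocks skipped so far stay accounted for.\<close>

definition dominated :: "('a \<Rightarrow> 'a \<Rightarrow> bool) \<Rightarrow> nat set \<Rightarrow> (nat \<Rightarrow> 'a set) \<Rightarrow> nat \<Rightarrow> 'a set \<Rightarrow> 'a set" where
  "dominated r I Q j U = {v\<in>U. \<exists>i\<in>I. i < j \<and> (\<forall>a\<in>Q i. r a v)}"

lemma dominated_mono:
  assumes "I \<subseteq> I'" "\<And>i. i \<in> I \<Longrightarrow> Q' i \<subseteq> Q i"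
  shows "dominated r I Q j U \<subseteq> dominated r I' Q' j U"
  using assms unfolding dominated_def by blast

text \<open>Induction on the number of blocks, for all target sizes \<open>y\<close> at once, since
  treating the last block shrinks the cliques already found. Either half of the last block has at
  least \<open>y\<close> blue neighbours in every earlier clique, and a new clique is added, or the
  block is skipped. The restriction \<open>i < j\<close> in \<open>dominated\<close> is kept because
  pages inside the blocks must come after the spine.\<close>

lemma greedy_clique_system:
  assumes y: "0 < y"
  shows "\<exists>x. \<forall>(r :: 'a \<Rightarrow> 'a \<Rightarrow> bool) U. (\<forall>a b. r a b \<longleftrightarrow> r b a) \<longrightarrow> (\<forall>i<T. half_rich r x (U i)) \<longrightarrow>
    (\<exists>I\<subseteq>{..<T}. \<exists>Q. clique_system r y I Q U \<and>
      (\<forall>j<T. j \<notin> I \<longrightarrow> card (U j) \<le> 4 * card (dominated r I Q j (U j))))"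
  using y
proof (induction T arbitrary: y)
  case 0
  then show ?case by (auto simp: clique_system_def)
next
  case (Suc T)
  \<comment> \<open>Large enough to cut each earlier clique into \<open>2 * y\<close> pieces of size
    \<open>y\<close>, as \<open>common_piece\<close> requires.\<close>
  define z where "z = 2 * y * y"
  have z: "0 < z" using Suc.prems by (simp add: z_def)
  obtain x where x: "\<forall>(r :: 'a \<Rightarrow> 'a \<Rightarrow> bool) U. (\<forall>a b. r a b \<longleftrightarrow> r b a) \<longrightarrow> (\<forall>i<T. half_rich r x (U i)) \<longrightarrow>
    (\<exists>I\<subseteq>{..<T}. \<exists>Q. clique_system r z I Q U \<and>
      (\<forall>j<T. j \<notin> I \<longrightarrow> card (U j) \<le> 4 * card (dominated r I Q j (U j))))"
    using Suc.IH[OF z] by (elim exE)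
  \<comment> \<open>The earlier cliques have at most \<open>T * z\<close> vertices in total, so
    among \<open>w\<close> new vertices some \<open>y\<close> have the same blue neighbourhood
    there.\<close>
  define w where "w = y * 2 ^ (T * z)"
  show ?case
  proof (intro exI[of _ "max x w"] allI impI)
    fix r :: "'a \<Rightarrow> 'a \<Rightarrow> bool" and U
    assume sym: "\<forall>a b. r a b \<longleftrightarrow> r b a" and U: "\<forall>i<Suc T. half_rich r (max x w) (U i)"
    then have Ux: "half_rich r x (U i)" "half_rich r w (U i)" if "i < Suc T" for i
      using that half_rich_mono[of r "max x w" "U i"] by simp_all
    then have "\<forall>i<T. half_rich r x (U i)" by simp
    with sym have "\<exists>I\<subseteq>{..<T}. \<exists>Q. clique_system r z I Q U \<and>
        (\<forall>j<T. j \<notin> I \<longrightarrow> card (U j) \<le> 4 * card (dominated r I Q j (U j)))"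
      by (intro x[rule_format]) simp_all
    then obtain I Q where I: "I \<subseteq> {..<T}" and Q: "clique_system r z I Q U"
      and skip: "\<And>j. j < T \<Longrightarrow> j \<notin> I \<Longrightarrow> card (U j) \<le> 4 * card (dominated r I Q j (U j))"
      by blast
    have fI: "finite I" "card I \<le> T"
      using finite_subset[OF I] card_mono[OF finite_lessThan I] by simp_all
    have fU: "finite (U j)" if "j < Suc T" for j using U that by (simp add: half_rich_def)
    have cQ: "card (Q i) = z" "finite (Q i)" if "i \<in> I" for i
    proof -
      show "card (Q i) = z" using Q that by (simp add: clique_system_def)
      then show "finite (Q i)" using z by (intro card_ge_0_finite) simp
    qed
    \<comment> \<open>The usable vertices: a new clique found among them can be made completely blue
      to size-\<open>y\<close> subsets of all earlier cliques.\<close>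
    define W where "W = {v\<in>U T. \<forall>i\<in>I. y \<le> card {a\<in>Q i. \<not> r a v}}"
    have skip_mono: "card (U j) \<le> 4 * card (dominated r I' Q' j (U j))"
      if "j < T" "j \<notin> I" "I \<subseteq> I'" "\<And>i. i \<in> I \<Longrightarrow> Q' i \<subseteq> Q i" for j I' and Q' :: "nat \<Rightarrow> 'a set"
    proof -
      have "card (dominated r I Q j (U j)) \<le> card (dominated r I' Q' j (U j))"
      proof (rule card_mono)
        show "finite (dominated r I' Q' j (U j))"
          using fU[of j] that(1) by (simp add: dominated_def)
        show "dominated r I Q j (U j) \<subseteq> dominated r I' Q' j (U j)"
          using that(3,4) by (rule dominated_mono)
      qed
      then show ?thesis using skip[OF that(1,2)] by linarith
    qed
    show "\<exists>I\<subseteq>{..<Suc T}. \<exists>Q. clique_system r y I Q U \<and>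
      (\<forall>j<Suc T. j \<notin> I \<longrightarrow> card (U j) \<le> 4 * card (dominated r I Q j (U j)))"
    proof (cases "card (U T) \<le> 2 * card W")
      case True
      have "half_rich r w (U T)" using Ux by simp
      moreover have WU: "W \<subseteq> U T" by (auto simp: W_def)
      ultimately obtain Z where Z: "Z \<subseteq> W" "card Z = w" "rel_clique r Z"
        using True unfolding half_rich_def by blast
      define A where "A = (\<Union>i\<in>I. Q i)"
      have fA: "finite A" using fI cQ by (simp add: A_def)
      have "card A \<le> (\<Sum>i\<in>I. card (Q i))" unfolding A_def using fI by (intro card_UN_le)
      also have "\<dots> \<le> T * z" using cQ fI by simp
      finally have cA: "card A \<le> T * z" .
      have fZ: "finite Z" using Z WU fU[of T] by (meson finite_subset lessI)
      obtain N where N: "N \<subseteq> A" "y \<le> card {v\<in>Z. {a\<in>A. \<not> r a v} = N}"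
        by (rule pigeonhole_fibre[of Z "\<lambda>v. {a\<in>A. \<not> r a v}" A "T * z" y])
          (use fZ fA cA Z in \<open>auto simp: w_def\<close>)
      obtain Y where Y: "Y \<subseteq> {v\<in>Z. {a\<in>A. \<not> r a v} = N}" "card Y = y"
        using obtain_subset_with_card_n[OF N(2)] by blast
      have "Y \<noteq> {}" using Y(2) Suc.prems by auto
      then obtain v0 where v0: "v0 \<in> Y" by blast
      have many: "y \<le> card (Q i \<inter> N)" if i: "i \<in> I" for i
      proof -
        have "v0 \<in> W" "{a\<in>A. \<not> r a v0} = N" using v0 Y Z by auto
        then have "y \<le> card {a\<in>Q i. \<not> r a v0}" "{a\<in>Q i. \<not> r a v0} = Q i \<inter> N"
          using i by (auto simp: W_def A_def)
        then show ?thesis by simp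
      qed
      have "\<forall>i. i \<in> I \<longrightarrow> (\<exists>S\<subseteq>Q i \<inter> N. card S = y)"
        using many obtain_subset_with_card_n by metis
      then obtain S where S: "\<And>i. i \<in> I \<Longrightarrow> S i \<subseteq> Q i \<inter> N" "\<And>i. i \<in> I \<Longrightarrow> card (S i) = y"
        by metis
      define Q' where "Q' = S(T := Y)"
      have TI: "T \<notin> I" using I by auto
      have Q'T: "Q' T = Y" by (simp add: Q'_def)
      have Q'I: "Q' i = S i" if "i \<in> I" for i using that TI by (auto simp: Q'_def)
      have sub: "Q' i \<subseteq> Q i" if "i \<in> I" for i using S(1)[OF that] Q'I[OF that] by auto
      have sys: "clique_system r y I Q' U"
        using clique_system_shrink[OF Q sub] S(2) Q'I by simp
      have cross: "\<not> r a b" if "i \<in> I" "a \<in> Q' i" "b \<in> Y" for i a b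
      proof -
        have "a \<in> N" "{a\<in>A. \<not> r a b} = N" using that S(1)[of i] Q'I[of i] Y by auto
        \<comment> \<open>All of \<open>Y\<close> has blue neighbourhood exactly \<open>N\<close>,
          and the shrunken cliques lie in \<open>N\<close>.\<close>
        then show ?thesis by auto
      qed
      have YU: "Y \<subseteq> U T" "rel_clique r Y"
      proof -
        have YZ: "Y \<subseteq> Z" using Y(1) by blast
        then show "Y \<subseteq> U T" using Z(1) WU by blast
        show "rel_clique r Y" using Z(3) YZ by (rule rel_clique_mono)
      qed
      have "clique_system r y (insert T I) Q' U"
        unfolding clique_system_def
      proof (intro conjI ballI impI)
        fix i assume i: "i \<in> insert T I"
        have "Q' i \<subseteq> U i" "card (Q' i) = y" "rel_clique r (Q' i)" if "i \<in> I"
          using sys that by (simp_all add: clique_system_def)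
        then show "Q' i \<subseteq> U i" "card (Q' i) = y" "rel_clique r (Q' i)"
          using i YU Y(2) by (cases "i = T"; simp add: Q'T)+
      next
        fix i j a b assume "i \<in> insert T I" "j \<in> insert T I" "i \<noteq> j" "a \<in> Q' i" "b \<in> Q' j"
        then show "\<not> r a b"
          using sys cross sym Q'T unfolding clique_system_def by (metis insert_iff)
      qed
      moreover have "\<forall>j<Suc T. j \<notin> insert T I \<longrightarrow>
          card (U j) \<le> 4 * card (dominated r (insert T I) Q' j (U j))"
      proof (intro allI impI)
        fix j assume "j < Suc T" "j \<notin> insert T I"
        then show "card (U j) \<le> 4 * card (dominated r (insert T I) Q' j (U j))"
          by (intro skip_mono sub) auto
      qed
      moreover have "insert T I \<subseteq> {..<Suc T}" using I by auto
      ultimately show ?thesis by blast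
    next
      case False
      \<comment> \<open>At least half of the block is unusable, and \<open>common_piece\<close>
        picks one index \<open>k\<close> for all cliques such that half of \<open>X\<close> is red
        to some \<open>P i k\<close>. This is the origin of the factor 4.\<close>
      define X where "X = U T - W"
      have fX: "finite X" using fU by (simp add: X_def)
      have "card (U T) = card W + card X"
        using fU[of T] card_mono[of "U T" W] by (simp add: X_def W_def card_Diff_subset)
      then have cX: "card (U T) \<le> 2 * card X" using False by simp
      have "\<forall>i. i \<in> I \<longrightarrow> (\<exists>P. (\<forall>k<2 * y. P k \<subseteq> Q i \<and> card (P k) = y) \<and>
          (\<forall>k<2 * y. \<forall>l<2 * y. k \<noteq> l \<longrightarrow> P k \<inter> P l = {}))"
      proof (intro allI impI)
        fix i assume "i \<in> I"
        then have "card (Q i) = (2 * y) * y" using cQ by (simp add: z_def)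
        then obtain P where "\<And>k. k < 2 * y \<Longrightarrow> P k \<subseteq> Q i" "\<And>k. k < 2 * y \<Longrightarrow> card (P k) = y"
          "\<And>k l. k < 2 * y \<Longrightarrow> l < 2 * y \<Longrightarrow> k \<noteq> l \<Longrightarrow> P k \<inter> P l = {}"
          using split_into_pieces by blast
        then show "\<exists>P. (\<forall>k<2 * y. P k \<subseteq> Q i \<and> card (P k) = y) \<and>
          (\<forall>k<2 * y. \<forall>l<2 * y. k \<noteq> l \<longrightarrow> P k \<inter> P l = {})" by blast
      qed
      then obtain P where P: "\<And>i k. i \<in> I \<Longrightarrow> k < 2 * y \<Longrightarrow> P i k \<subseteq> Q i \<and> card (P i k) = y"
        "\<And>i k l. i \<in> I \<Longrightarrow> k < 2 * y \<Longrightarrow> l < 2 * y \<Longrightarrow> k \<noteq> l \<Longrightarrow> P i k \<inter> P i l = {}"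
        by metis
      have few: "\<exists>i\<in>I. card {a\<in>Q i. \<not> r a v} < y" if "v \<in> X" for v
        using that by (auto simp: X_def W_def not_le)
      obtain k where k: "k < 2 * y" "card X \<le> 2 * card {v\<in>X. \<exists>i\<in>I. \<forall>a\<in>P i k. r a v}"
        by (rule common_piece[OF Suc.prems fX, of I P Q r]) (use P cQ few in blast)+
      define Q' where "Q' = (\<lambda>i. P i k)"
      have sub: "Q' i \<subseteq> Q i" if "i \<in> I" for i using P(1)[OF that k(1)] by (simp add: Q'_def)
      have "card {v\<in>X. \<exists>i\<in>I. \<forall>a\<in>P i k. r a v} \<le> card (dominated r I Q' T (U T))"
        using I fU[of T] by (intro card_mono) (auto simp: dominated_def Q'_def X_def)
      then have last: "card (U T) \<le> 4 * card (dominated r I Q' T (U T))"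
        using cX k(2) by linarith
      have "clique_system r y I Q' U"
        using clique_system_shrink[OF Q sub] P(1) k(1) by (simp add: Q'_def)
      moreover have "\<forall>j<Suc T. j \<notin> I \<longrightarrow> card (U j) \<le> 4 * card (dominated r I Q' j (U j))"
      proof (intro allI impI)
        fix j assume "j < Suc T" "j \<notin> I"
        then show "card (U j) \<le> 4 * card (dominated r I Q' j (U j))"
          using last by (cases "j = T") (auto intro!: skip_mono sub)
      qed
      moreover have "I \<subseteq> {..<Suc T}" using I by auto
      ultimately show ?thesis by blast
    qed
  qed
qed

section \<open>Averaging over the pages\<close>

text \<open>In the variable \<open>ln (2 * x)\<close>, the left side is the tangent of the right
  side at \<open>x = 1 / 2\<close>. With \<open>u = 2 * x\<close>, the difference is
  \<open>g u - g 1\<close>, and the sign of the derivative of \<open>g\<close> is that of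
  \<open>1 - h u\<close>. Since \<open>h\<close> decreases from \<open>2 / m\<close> on and
  \<open>h 1 = 1\<close>, the minimum of \<open>g\<close> is at 1.\<close>

lemma power_ge_tangent:
  fixes x :: real
  assumes m: "2 \<le> m" and x: "1 / real m \<le> x" "x \<le> 1"
  shows "1 - real m * ln (2 * x) \<le> (2 * (1 - x)) ^ m"
proof -
  define g where "g = (\<lambda>u::real. (2 - u) ^ m + real m * ln u)"
  define h where "h = (\<lambda>u::real. u * (2 - u) ^ (m - 1))"
  \<comment> \<open>The critical point of \<open>h\<close>; it corresponds to the assumed lower
    bound \<open>1 / m\<close> for \<open>x\<close>.\<close>
  define a where "a = 2 / real m"
  have a: "0 < a" "a \<le> 1" using m by (auto simp: a_def)
  from m obtain k where "m = 2 + k" using le_Suc_ex by blast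
  then have k: "m = Suc (Suc k)" by simp
  have dh: "(h has_real_derivative (2 - u) ^ k * (2 - real m * u)) (at u)" for u
  proof -
    have "((\<lambda>u. (2 - u) ^ Suc k) has_real_derivative (1 + real k) * (- 1 * (2 - u) ^ k)) (at u)"
      by (rule DERIV_power_Suc) (auto intro!: derivative_eq_intros)
    from DERIV_mult[OF DERIV_ident this]
    have "(h has_real_derivative 1 * (2 - u) ^ Suc k + (1 + real k) * (- 1 * (2 - u) ^ k) * u) (at u)"
      unfolding h_def k by simp
    then show ?thesis by (rule DERIV_cong) (simp add: k algebra_simps)
  qed
  have anti: "h v \<le> h u" if "a \<le> u" "u \<le> v" "v \<le> 2" for u v
  proof (rule DERIV_nonpos_imp_nonincreasing[OF that(2)])
    fix t assume t: "u \<le> t" "t \<le> v"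
    have "2 \<le> real m * u" using that m by (simp add: a_def field_simps)
    also have "\<dots> \<le> real m * t" using t by (intro mult_left_mono) auto
    finally have "2 \<le> real m * t" .
    then have "(2 - t) ^ k * (2 - real m * t) \<le> 0"
      using t that by (intro mult_nonneg_nonpos) auto
    then show "\<exists>y. DERIV h t :> y \<and> y \<le> 0" using dh by blast
  qed
  have h1: "h 1 = 1" by (simp add: h_def)
  have dg: "(g has_real_derivative real m / u * (1 - h u)) (at u)" if "0 < u" for u
  proof -
    have "(g has_real_derivative - (real m * (2 - u) ^ (m - 1)) + real m * (1 / u)) (at u)"
      unfolding g_def using that by (auto intro!: derivative_eq_intros simp: field_simps)
    moreover have "- (real m * (2 - u) ^ (m - 1)) + real m * (1 / u) = real m / u * (1 - h u)"
      using that by (simp add: h_def field_simps)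
    ultimately show ?thesis by simp
  qed
  have "g 1 \<le> g u" if u: "a \<le> u" "u \<le> 2" for u
  proof (cases "u \<le> 1")
    case True
    show ?thesis
    proof (rule DERIV_nonpos_imp_nonincreasing[OF True])
      fix t assume t: "u \<le> t" "t \<le> 1"
      then have "1 \<le> h t" using anti[of t 1] u h1 by simp
      then have "real m / t * (1 - h t) \<le> 0"
        using t u a by (intro mult_nonneg_nonpos) auto
      then show "\<exists>y. DERIV g t :> y \<and> y \<le> 0" using dg[of t] t u a by force
    qed
  next
    case False
    then have "1 \<le> u" by simp
    then show ?thesis
    proof (rule DERIV_nonneg_imp_nondecreasing)
      fix t assume t: "1 \<le> t" "t \<le> u"
      then have "h t \<le> 1" using anti[of 1 t] u a h1 by simp
      then have "0 \<le> real m / t * (1 - h t)" using t by simp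
      then show "\<exists>y. DERIV g t :> y \<and> 0 \<le> y" using dg[of t] t by force
    qed
  qed
  from this[of "2 * x"] x show ?thesis
    using m by (simp add: g_def a_def field_simps)
qed

text \<open>The base is the reciprocal of \<open>1 + 1 / (m - 1)\<close>, so \<open>m - 1\<close> of
  the factors give at least \<open>1 / exp 1 \<ge> 1 / 3\<close>, and the last one gives at least
  \<open>1 / 2\<close>.\<close>

lemma power_one_minus_ge:
  assumes "2 \<le> m"
  shows "1 / 6 \<le> (1 - 1 / real m) ^ m"
proof -
  obtain k where m: "m = Suc k" and k: "1 \<le> k" using assms by (cases m) auto
  have "(1 + 1 / real k) ^ k \<le> exp (1 / real k) ^ k"
    by (intro power_mono) (auto simp: add.commute)
  also have "\<dots> = exp 1" using k by (simp add: exp_of_nat_mult[symmetric])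
  also have "\<dots> \<le> 3" by (rule exp_le)
  finally have "(1 + 1 / real k) ^ k \<le> 3" .
  moreover have "0 < (1 + 1 / real k) ^ k" by (intro zero_less_power add_pos_nonneg) auto
  ultimately have "1 / 3 \<le> 1 / (1 + 1 / real k) ^ k" by (simp add: field_simps)
  also have "\<dots> = (1 - 1 / real m) ^ k"
    using k by (simp add: m power_one_over[symmetric] field_simps)
  finally have "1 / 3 \<le> (1 - 1 / real m) ^ k" .
  moreover have "1 / 2 \<le> 1 - 1 / real m" using k by (simp add: m field_simps)
  ultimately have "1 / 2 * (1 / 3) \<le> (1 - 1 / real m) * (1 - 1 / real m) ^ k"
    by (intro mult_mono) auto
  then show ?thesis by (simp add: m)
qed

lemma two_mult_le_power: "1 \<le> m \<Longrightarrow> 2 * real m \<le> 2 ^ m"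
  by (induction m rule: nat_induct_at_least) auto

text \<open>If every \<open>x i\<close> is at least \<open>1 / m\<close>, the tangent bounds add up
  to a bound in \<open>ln P\<close> with \<open>P = 2 ^ m * (\<Prod>i\<in>I. x i)\<close>, and
  \<open>ln P \<le> P - 1\<close> even gives \<open>2 / 2 ^ m\<close>. Otherwise a single small
  \<open>x i\<close> contributes at least \<open>1 / (6 * m)\<close>, and
  \<open>2 * m \<le> 2 ^ m\<close>; this case determines the constant 3.\<close>

lemma prod_plus_mean_power:
  fixes x :: "'i \<Rightarrow> real"
  assumes I: "finite I" "card I = m" and m: "2 \<le> m" and x: "\<And>i. i \<in> I \<Longrightarrow> 0 \<le> x i \<and> x i \<le> 1"
  shows "1 / (3 * 2 ^ m) \<le> (\<Prod>i\<in>I. x i) + (\<Sum>i\<in>I. (1 - x i) ^ m) / real m"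
proof (cases "\<forall>i\<in>I. 1 / real m \<le> x i")
  case True
  have pos: "0 < x i" if "i \<in> I" for i
  proof -
    have "0 < 1 / real m" using m by simp
    then show ?thesis using True that by (meson less_le_trans)
  qed
  define P where "P = (\<Prod>i\<in>I. 2 * x i)"
  have P: "0 < P" unfolding P_def using pos by (intro prod_pos) simp
  have PP: "P = 2 ^ m * (\<Prod>i\<in>I. x i)" unfolding P_def using I by (simp add: prod.distrib)
  have "(\<Sum>i\<in>I. 1 - real m * ln (2 * x i)) \<le> (\<Sum>i\<in>I. (2 * (1 - x i)) ^ m)"
    using power_ge_tangent[OF m] True x by (intro sum_mono) auto
  moreover have "(\<Sum>i\<in>I. ln (2 * x i)) = ln P"
    unfolding P_def by (rule ln_prod[symmetric]) (use I pos in fastforce)+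
  moreover have "(\<Sum>i\<in>I. 1 - real m * ln (2 * x i)) = real m - real m * (\<Sum>i\<in>I. ln (2 * x i))"
    using I by (simp add: sum_subtractf sum_distrib_left)
  moreover have "(\<Sum>i\<in>I. (2 * (1 - x i)) ^ m) = 2 ^ m * (\<Sum>i\<in>I. (1 - x i) ^ m)"
    by (simp only: power_mult_distrib sum_distrib_left)
  ultimately have "real m - real m * ln P \<le> 2 ^ m * (\<Sum>i\<in>I. (1 - x i) ^ m)" by simp
  moreover have "ln P \<le> P - 1" using P by (rule ln_le_minus_one)
  then have "real m * ln P \<le> real m * (P - 1)" by (rule mult_left_mono) simp
  ultimately have "2 * real m \<le> real m * P + 2 ^ m * (\<Sum>i\<in>I. (1 - x i) ^ m)"
    by (simp add: algebra_simps)
  then have "2 \<le> 2 ^ m * ((\<Prod>i\<in>I. x i) + (\<Sum>i\<in>I. (1 - x i) ^ m) / real m)"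
    using m unfolding PP by (simp add: field_simps)
  then show ?thesis using m by (simp add: field_simps)
next
  case False
  then obtain i where i: "i \<in> I" "x i < 1 / real m" by force
  have "1 / 6 \<le> (1 - 1 / real m) ^ m" using m by (rule power_one_minus_ge)
  also have "\<dots> \<le> (1 - x i) ^ m" using i m by (intro power_mono) auto
  also have "\<dots> \<le> (\<Sum>i\<in>I. (1 - x i) ^ m)" using i I x by (intro member_le_sum) auto
  finally have "1 / 6 / real m \<le> (\<Sum>i\<in>I. (1 - x i) ^ m) / real m"
    by (rule divide_right_mono) simp
  moreover have "1 / (3 * 2 ^ m) \<le> 1 / (3 * (2 * real m))"
    using two_mult_le_power[of m] m by (intro divide_left_mono) auto
  moreover have "0 \<le> (\<Prod>i\<in>I. x i)" using x by (intro prod_nonneg) auto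
  ultimately show ?thesis by simp
qed

lemma power_diff_le:
  fixes a b :: real
  assumes "0 \<le> b" "b \<le> a" "a \<le> 1"
  shows "a ^ m - b ^ m \<le> real m * (a - b)"
proof (induction m)
  case (Suc m)
  have "a ^ Suc m - b ^ Suc m = a * (a ^ m - b ^ m) + (a - b) * b ^ m"
    by (simp add: algebra_simps)
  also have "\<dots> \<le> 1 * (a ^ m - b ^ m) + (a - b) * 1"
    using assms by (intro add_mono mult_right_mono mult_left_mono) (auto simp: power_mono power_le_one)
  finally show ?case using Suc by (simp add: algebra_simps)
qed simp

lemma power_le_fact_binomial: "(n - m) ^ m \<le> fact m * (n choose m)"
proof (induction m arbitrary: n)
  case (Suc m)
  show ?case
  proof (cases n)
    case (Suc k)
    have "(n - Suc m) ^ Suc m = (k - m) * (k - m) ^ m" by (simp add: Suc)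
    also have "\<dots> \<le> Suc k * (fact m * (k choose m))"
      using Suc.IH[of k] by (intro mult_mono) auto
    also have "\<dots> = fact m * (Suc m * (Suc k choose Suc m))"
      by (simp only: Suc_times_binomial) (simp add: ac_simps)
    finally show ?thesis by (simp add: Suc algebra_simps)
  qed simp
qed simp

text \<open>Sampling without replacement compared with sampling with replacement: the ratio of
  binomials is at least \<open>((r - m) / l) ^ m\<close>, and lowering the base by at most
  \<open>m / l\<close> costs at most \<open>m\<close> times that.\<close>

lemma binomial_ratio_ge:
  assumes "r \<le> l" "m \<le> l" "0 < l"
  shows "(real r / real l) ^ m - real m * real m / real l \<le> real (r choose m) / real (l choose m)"
proof -
  define a b where "a = real r / real l" and "b = real (r - m) / real l"
  have ab: "0 \<le> b" "b \<le> a" "a \<le> 1" using assms by (auto simp: a_def b_def divide_right_mono)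
  have "a - b \<le> real m / real l"
    unfolding a_def b_def diff_divide_distrib[symmetric] by (intro divide_right_mono) auto
  then have "real m * (a - b) \<le> real m * (real m / real l)" by (intro mult_left_mono) auto
  then have 1: "a ^ m - real m * real m / real l \<le> b ^ m" using power_diff_le[OF ab, of m] by simp
  have pos: "0 < l choose m" using assms by simp
  have "real ((r - m) ^ m) \<le> real (fact m * (r choose m))"
    using power_le_fact_binomial[of r m] by (simp only: of_nat_le_iff)
  moreover have "real (fact m * (l choose m)) \<le> real (l ^ m)"
    using binomial_fact_pow[of l m] by (simp only: of_nat_le_iff mult.commute)
  ultimately have "real ((r - m) ^ m) * real (fact m * (l choose m))
      \<le> real (fact m * (r choose m)) * real (l ^ m)"
    by (intro mult_mono) auto
  then have "real (r - m) ^ m * real (l choose m) \<le> real (r choose m) * real l ^ m"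
    by (simp add: ac_simps)
  then have "b ^ m \<le> real (r choose m) / real (l choose m)"
    unfolding b_def power_divide using pos assms by (simp add: field_simps)
  then show ?thesis using 1 unfolding a_def by linarith
qed

text \<open>For a page \<open>v\<close>, let \<open>x i\<close> be the fraction of
  \<open>Q i\<close> joined to \<open>v\<close> in blue. The product of the \<open>x i\<close> is
  the fraction of transversals \<open>f\<close> blue to \<open>v\<close>, and the binomial ratio is
  the fraction of \<open>m\<close>-subsets of \<open>Q i\<close> red to \<open>v\<close>. If both
  conclusions failed, summing over \<open>B\<close> would give at most \<open>n + n\<close>, whereas
  \<open>prod_plus_mean_power\<close> gives at least
  \<open>card B / (4 * 2 ^ m) \<ge> 4 * n\<close>.\<close>

lemma clique_system_pages:
  fixes r :: "'a \<Rightarrow> 'a \<Rightarrow> bool"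
  assumes sys: "clique_system r l I Q U" and I: "finite I" "card I = m" and m: "2 \<le> m"
    and l: "l = 12 * m\<^sup>2 * 2 ^ m" and B: "finite B" "2 ^ (m + 4) * n \<le> card B" and n: "1 \<le> n"
  shows "(\<exists>i\<in>I. \<exists>K\<subseteq>Q i. card K = m \<and> n \<le> card {v\<in>B. \<forall>a\<in>K. r a v}) \<or>
    (\<exists>f\<in>PiE I Q. n \<le> card {v\<in>B. \<forall>i\<in>I. \<not> r (f i) v})"
proof (rule ccontr)
  assume neg: "\<not> ?thesis"
  have neg_blue: "card {v\<in>B. \<forall>i\<in>I. \<not> r (f i) v} \<le> n" if "f \<in> PiE I Q" for f
  proof -
    have "\<not> n \<le> card {v\<in>B. \<forall>i\<in>I. \<not> r (f i) v}" using neg that by blast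
    then show ?thesis by simp
  qed
  have neg_red: "card {v\<in>B. \<forall>a\<in>K. r a v} \<le> n" if "i \<in> I" "K \<subseteq> Q i" "card K = m" for i K
  proof -
    have "\<not> n \<le> card {v\<in>B. \<forall>a\<in>K. r a v}" using neg that by blast
    then show ?thesis by simp
  qed
  have l0: "0 < l" "m \<le> l"
  proof -
    have "m * 1 \<le> m * (12 * m * 2 ^ m)" using m by (intro mult_left_mono) auto
    then show "m \<le> l" by (simp add: l power2_eq_square ac_simps)
    then show "0 < l" using m by simp
  qed
  have cQ: "card (Q i) = l" if "i \<in> I" for i using sys that by (simp add: clique_system_def)
  then have fQ: "finite (Q i)" if "i \<in> I" for i
    using l0 that by (intro card_ge_0_finite) simp
  define R where "R = (\<lambda>i v. card {a\<in>Q i. r a v})"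
  define L where "L = (\<lambda>i v. card {a\<in>Q i. \<not> r a v})"
  have RL: "R i v + L i v = l" if "i \<in> I" for i v
  proof -
    have "card ({a\<in>Q i. r a v} \<union> {a\<in>Q i. \<not> r a v}) = R i v + L i v"
      unfolding R_def L_def using fQ[OF that] by (intro card_Un_disjoint) auto
    moreover have "{a\<in>Q i. r a v} \<union> {a\<in>Q i. \<not> r a v} = Q i" by auto
    ultimately show ?thesis using cQ[OF that] by simp
  qed
  have blue: "(\<Sum>v\<in>B. \<Prod>i\<in>I. L i v) \<le> n * l ^ m"
  proof -
    have "(\<Sum>f\<in>PiE I Q. card {v\<in>B. \<forall>i\<in>I. \<not> r (f i) v}) = (\<Sum>v\<in>B. \<Prod>i\<in>I. L i v)"
    proof (rule sum_multicount_gen)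
      show "\<forall>v\<in>B. card {f \<in> PiE I Q. \<forall>i\<in>I. \<not> r (f i) v} = (\<Prod>i\<in>I. L i v)"
      proof
        fix v
        have "{f \<in> PiE I Q. \<forall>i\<in>I. \<not> r (f i) v} = PiE I (\<lambda>i. {a\<in>Q i. \<not> r a v})"
          by (auto simp: PiE_iff extensional_def)
        then show "card {f \<in> PiE I Q. \<forall>i\<in>I. \<not> r (f i) v} = (\<Prod>i\<in>I. L i v)"
          using I by (simp add: card_PiE L_def)
      qed
    qed (use I fQ B in \<open>auto intro: finite_PiE\<close>)
    moreover have "(\<Sum>f\<in>PiE I Q. card {v\<in>B. \<forall>i\<in>I. \<not> r (f i) v}) \<le> (\<Sum>f\<in>PiE I Q. n)"
      using neg_blue by (rule sum_mono)
    moreover have "card (PiE I Q) = l ^ m" using I cQ by (simp add: card_PiE)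
    ultimately show ?thesis by (simp add: mult.commute)
  qed
  have red: "(\<Sum>v\<in>B. R i v choose m) \<le> n * (l choose m)" if i: "i \<in> I" for i
  proof -
    let ?S = "{K. K \<subseteq> Q i \<and> card K = m}"
    have "(\<Sum>K\<in>?S. card {v\<in>B. \<forall>a\<in>K. r a v}) = (\<Sum>v\<in>B. R i v choose m)"
    proof (rule sum_multicount_gen)
      show "\<forall>v\<in>B. card {K\<in>?S. \<forall>a\<in>K. r a v} = R i v choose m"
      proof
        fix v
        have "{K\<in>?S. \<forall>a\<in>K. r a v} = {K. K \<subseteq> {a\<in>Q i. r a v} \<and> card K = m}" by auto
        then show "card {K\<in>?S. \<forall>a\<in>K. r a v} = R i v choose m"
          using fQ[OF i] by (simp add: n_subsets R_def)
      qed
    qed (use fQ[OF i] B in auto)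
    moreover have "(\<Sum>K\<in>?S. card {v\<in>B. \<forall>a\<in>K. r a v}) \<le> (\<Sum>K\<in>?S. n)"
    proof (rule sum_mono)
      fix K assume "K \<in> ?S"
      then show "card {v\<in>B. \<forall>a\<in>K. r a v} \<le> n" using neg_red[OF i] by simp
    qed
    moreover have "card ?S = l choose m" using fQ[OF i] cQ[OF i] by (simp add: n_subsets)
    ultimately show ?thesis by (simp add: mult.commute)
  qed
  \<comment> \<open>The reason for the value of \<open>l\<close>: the error of
    \<open>binomial_ratio_ge\<close> becomes \<open>1 / (12 * 2 ^ m)\<close>, and
    \<open>1 / 3 - 1 / 12 = 1 / 4\<close>.\<close>
  have lm: "real m * real m / real l = 1 / (12 * 2 ^ m)"
    using m by (simp add: l power2_eq_square)
  have vertex: "1 / (4 * 2 ^ m) \<le> (\<Prod>i\<in>I. real (L i v) / real l) +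
      (\<Sum>i\<in>I. real (R i v choose m) / real (l choose m)) / real m" for v
  proof -
    have "1 / (3 * 2 ^ m) \<le> (\<Prod>i\<in>I. real (L i v) / real l) +
        (\<Sum>i\<in>I. (1 - real (L i v) / real l) ^ m) / real m"
    proof (rule prod_plus_mean_power[OF I m])
      fix i assume "i \<in> I"
      then show "0 \<le> real (L i v) / real l \<and> real (L i v) / real l \<le> 1"
        using RL[of i v] l0 by (auto simp: divide_le_eq_1)
    qed
    also have "(\<Sum>i\<in>I. (1 - real (L i v) / real l) ^ m)
        \<le> (\<Sum>i\<in>I. real (R i v choose m) / real (l choose m) + 1 / (12 * 2 ^ m))"
    proof (rule sum_mono)
      fix i assume i: "i \<in> I"
      have "real (R i v) + real (L i v) = real l"
        using RL[OF i, of v] by (metis of_nat_add)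
      then have "1 - real (L i v) / real l = real (R i v) / real l"
        using l0 by (simp add: field_simps)
      then show "(1 - real (L i v) / real l) ^ m
          \<le> real (R i v choose m) / real (l choose m) + 1 / (12 * 2 ^ m)"
        using binomial_ratio_ge[of "R i v" l m] RL[OF i, of v] l0 lm by simp
    qed
    also have "\<dots> = (\<Sum>i\<in>I. real (R i v choose m) / real (l choose m)) + real m / (12 * 2 ^ m)"
      using I by (simp add: sum.distrib)
    finally have "1 / (3 * 2 ^ m) \<le> (\<Prod>i\<in>I. real (L i v) / real l) +
        ((\<Sum>i\<in>I. real (R i v choose m) / real (l choose m)) + real m / (12 * 2 ^ m)) / real m"
      by (simp add: divide_right_mono)
    then show ?thesis using m by (simp add: add_divide_distrib)
  qed
  have red_real: "real (\<Sum>v\<in>B. R i v choose m) \<le> real (n * (l choose m))" if "i \<in> I" for i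
    using red[OF that] by (simp only: of_nat_le_iff)
  have lc: "0 < real (l choose m)" using l0 by simp
  have "real (2 ^ (m + 4) * n) / (4 * 2 ^ m) \<le> real (card B) / (4 * 2 ^ m)"
    using B(2) by (intro divide_right_mono) (simp_all only: of_nat_le_iff, simp)
  also have "real (2 ^ (m + 4) * n) / (4 * 2 ^ m) = 4 * real n" by (simp add: power_add)
  also have "real (card B) / (4 * 2 ^ m) = (\<Sum>v\<in>B. 1 / (4 * 2 ^ m))" by simp
  also have "\<dots> \<le> (\<Sum>v\<in>B. (\<Prod>i\<in>I. real (L i v) / real l) +
      (\<Sum>i\<in>I. real (R i v choose m) / real (l choose m)) / real m)"
    using vertex by (intro sum_mono)
  also have "\<dots> = (\<Sum>v\<in>B. \<Prod>i\<in>I. real (L i v) / real l) +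
      (\<Sum>v\<in>B. (\<Sum>i\<in>I. real (R i v choose m) / real (l choose m)) / real m)"
    by (rule sum.distrib)
  also have "(\<Sum>v\<in>B. \<Prod>i\<in>I. real (L i v) / real l) = real (\<Sum>v\<in>B. \<Prod>i\<in>I. L i v) / real l ^ m"
    using I by (simp add: prod_dividef sum_divide_distrib)
  also have "\<dots> \<le> real (n * l ^ m) / real l ^ m"
    using blue by (intro divide_right_mono) (simp_all only: of_nat_le_iff, simp)
  also have "\<dots> = real n" using l0 by simp
  also have "(\<Sum>v\<in>B. (\<Sum>i\<in>I. real (R i v choose m) / real (l choose m)) / real m)
      = (\<Sum>i\<in>I. real (\<Sum>v\<in>B. R i v choose m)) / real (l choose m) / real m"
    by (simp add: sum_divide_distrib[symmetric] sum.swap[of _ I])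
  also have "\<dots> \<le> (\<Sum>i\<in>I. real (n * (l choose m))) / real (l choose m) / real m"
    using red_real by (intro divide_right_mono sum_mono) simp_all
  also have "\<dots> = real n" using I m lc by simp
  finally show False using n by simp
qed

text \<open>The three shapes to which the order of the host assigns the order of a book: a spine
  inside one block with pages in later blocks or in \<open>B\<close>, and a transversal spine in the
  other colour with pages in \<open>B\<close>.\<close>

definition spine_with_pages ::
  "nat \<Rightarrow> nat \<Rightarrow> ('a \<Rightarrow> 'a \<Rightarrow> bool) \<Rightarrow> (nat \<Rightarrow> 'a set) \<Rightarrow> 'a set \<Rightarrow> bool" where
  "spine_with_pages m n r U B \<longleftrightarrow>
    (\<exists>j<2 * m. \<exists>K\<subseteq>U j. card K = m \<and> rel_clique r K \<and>
      (n \<le> card {v\<in>(\<Union>k\<in>{j<..<2 * m}. U k). \<forall>a\<in>K. r a v} \<or> n \<le> card {v\<in>B. \<forall>a\<in>K. r a v})) \<or>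
    (\<exists>I\<subseteq>{..<2 * m}. \<exists>f. card I = m \<and> (\<forall>i\<in>I. f i \<in> U i) \<and>
      (\<forall>i\<in>I. \<forall>j\<in>I. i \<noteq> j \<longrightarrow> \<not> r (f i) (f j)) \<and> n \<le> card {v\<in>B. \<forall>i\<in>I. \<not> r (f i) v})"

text \<open>With \<open>m\<close> cliques available, \<open>clique_system_pages\<close> finishes.
  Otherwise at least \<open>m\<close> blocks were skipped, and each has at least
  \<open>4 * n / 4 = n\<close> vertices completely red to an earlier clique. These
  \<open>m * n\<close> or more distinct vertices are shared by fewer than \<open>m\<close> cliques,
  so one clique has \<open>n\<close> red pages in later blocks.\<close>

lemma monochromatic_spine:
  assumes m: "2 \<le> m"
  shows "\<exists>x. \<forall>(r :: 'a \<Rightarrow> 'a \<Rightarrow> bool) U B n. (\<forall>a b. r a b \<longleftrightarrow> r b a) \<longrightarrow>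
      (\<forall>i<2 * m. half_rich r x (U i) \<and> 4 * n \<le> card (U i)) \<longrightarrow>
      (\<forall>i<2 * m. \<forall>j<2 * m. i \<noteq> j \<longrightarrow> U i \<inter> U j = {}) \<longrightarrow>
      finite B \<longrightarrow> 2 ^ (m + 4) * n \<le> card B \<longrightarrow> 1 \<le> n \<longrightarrow>
      spine_with_pages m n r U B"
proof -
  define l where "l = 12 * m\<^sup>2 * 2 ^ m"
  have l: "0 < l" "m \<le> l"
  proof -
    have "m * 1 \<le> m * (12 * m * 2 ^ m)" using m by (intro mult_left_mono) auto
    then show "m \<le> l" by (simp add: l_def power2_eq_square ac_simps)
    then show "0 < l" using m by simp
  qed
  obtain x where x: "\<forall>(r :: 'a \<Rightarrow> 'a \<Rightarrow> bool) U. (\<forall>a b. r a b \<longleftrightarrow> r b a) \<longrightarrow> (\<forall>i<2 * m. half_rich r x (U i)) \<longrightarrow>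
    (\<exists>I\<subseteq>{..<2 * m}. \<exists>Q. clique_system r l I Q U \<and>
      (\<forall>j<2 * m. j \<notin> I \<longrightarrow> card (U j) \<le> 4 * card (dominated r I Q j (U j))))"
    using greedy_clique_system[OF l(1), of "2 * m"] by (rule exE)
  show ?thesis
  proof (intro exI[of _ x] allI impI)
    fix r :: "'a \<Rightarrow> 'a \<Rightarrow> bool" and U :: "nat \<Rightarrow> 'a set" and B :: "'a set" and n
    assume sym: "\<forall>a b. r a b \<longleftrightarrow> r b a"
      and U: "\<forall>i<2 * m. half_rich r x (U i) \<and> 4 * n \<le> card (U i)"
      and disj: "\<forall>i<2 * m. \<forall>j<2 * m. i \<noteq> j \<longrightarrow> U i \<inter> U j = {}"
      and B: "finite B" "2 ^ (m + 4) * n \<le> card B" and n: "1 \<le> n"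
    have "\<exists>I\<subseteq>{..<2 * m}. \<exists>Q. clique_system r l I Q U \<and>
        (\<forall>j<2 * m. j \<notin> I \<longrightarrow> card (U j) \<le> 4 * card (dominated r I Q j (U j)))"
      using sym U by (intro x[rule_format]) simp_all
    then obtain I Q where I: "I \<subseteq> {..<2 * m}" and Q: "clique_system r l I Q U"
      and skip: "\<And>j. j < 2 * m \<Longrightarrow> j \<notin> I \<Longrightarrow> card (U j) \<le> 4 * card (dominated r I Q j (U j))"
      by blast
    have fU: "finite (U i)" if "i < 2 * m" for i using U that by (simp add: half_rich_def)
    have fI: "finite I" using I finite_subset by blast
    have QU: "Q i \<subseteq> U i" "card (Q i) = l" "rel_clique r (Q i)" if "i \<in> I" for i
      using Q that by (simp_all add: clique_system_def)
    show "spine_with_pages m n r U B"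
    proof (cases "m \<le> card I")
      case True
      then obtain I' where I': "I' \<subseteq> I" "card I' = m" using obtain_subset_with_card_n by blast
      have sys: "clique_system r l I' Q U" using Q I' unfolding clique_system_def by blast
      from clique_system_pages[OF sys _ I'(2) m l_def B n] I' fI consider
        (red) i K where "i \<in> I'" "K \<subseteq> Q i" "card K = m" "n \<le> card {v\<in>B. \<forall>a\<in>K. r a v}"
        | (blue) f where "f \<in> PiE I' Q" "n \<le> card {v\<in>B. \<forall>i\<in>I'. \<not> r (f i) v}"
        using finite_subset by blast
      then show ?thesis
      proof cases
        case red
        then have iI: "i \<in> I" using I' by blast
        then have "i < 2 * m" "K \<subseteq> U i" "rel_clique r K"
          using I iI subset_trans[OF red(2) QU(1)[OF iI]] rel_clique_mono[OF QU(3)[OF iI] red(2)]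
          by auto
        then show ?thesis using red unfolding spine_with_pages_def by blast
      next
        case blue
        have "f i \<in> Q i" if "i \<in> I'" for i using blue that by auto
        then have "\<forall>i\<in>I'. f i \<in> U i" "\<forall>i\<in>I'. \<forall>j\<in>I'. i \<noteq> j \<longrightarrow> \<not> r (f i) (f j)"
          using sys unfolding clique_system_def by blast+
        moreover have "I' \<subseteq> {..<2 * m}" using I I' by blast
        ultimately show ?thesis using blue I' unfolding spine_with_pages_def by blast
      qed
    next
      case False
      define J where "J = {..<2 * m} - I"
      define D where "D = (\<Union>j\<in>J. dominated r I Q j (U j))"
      have "card J = 2 * m - card I" using I fI by (simp add: J_def card_Diff_subset)
      then have cJ: "m \<le> card J" using False by simp
      have "card J * n = (\<Sum>j\<in>J. n)" by simp
      also have "\<dots> \<le> (\<Sum>j\<in>J. card (dominated r I Q j (U j)))"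
      proof (rule sum_mono)
        fix j assume "j \<in> J"
        then have "4 * n \<le> card (U j)" "card (U j) \<le> 4 * card (dominated r I Q j (U j))"
          using U skip[of j] by (auto simp: J_def)
        then show "n \<le> card (dominated r I Q j (U j))" by linarith
      qed
      also have "\<dots> = card D"
        unfolding D_def
      proof (rule card_UN_disjoint[symmetric])
        show "\<forall>j\<in>J. finite (dominated r I Q j (U j))" using fU by (auto simp: J_def dominated_def)
        show "\<forall>i\<in>J. \<forall>j\<in>J. i \<noteq> j \<longrightarrow> dominated r I Q i (U i) \<inter> dominated r I Q j (U j) = {}"
          using disj unfolding J_def dominated_def by blast
      qed (simp add: J_def)
      finally have cD: "card J * n \<le> card D" .
      let ?P = "\<lambda>i. {v\<in>(\<Union>k\<in>{i<..<2 * m}. U k). \<forall>a\<in>Q i. r a v}"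
      have fP: "finite (?P i)" for i using fU by auto
      have "D \<subseteq> (\<Union>i\<in>I. ?P i)"
      proof
        fix v assume "v \<in> D"
        then obtain i j where ij: "i \<in> I" "i < j" "j < 2 * m" "v \<in> U j" "\<forall>a\<in>Q i. r a v"
          unfolding D_def J_def dominated_def by blast
        then have "v \<in> ?P i" by auto
        then show "v \<in> (\<Union>i\<in>I. ?P i)" using ij(1) by blast
      qed
      then have "card D \<le> card (\<Union>i\<in>I. ?P i)" using fI fP by (intro card_mono) blast+
      also have "\<dots> \<le> (\<Sum>i\<in>I. card (?P i))" using fI by (rule card_UN_le)
      finally have sum: "m * n \<le> (\<Sum>i\<in>I. card (?P i))"
        using cD cJ by (meson le_trans mult_le_mono1)
      have "\<exists>i\<in>I. n \<le> card (?P i)"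
      proof (rule ccontr)
        assume "\<not> ?thesis"
        then have "(\<Sum>i\<in>I. card (?P i)) \<le> (\<Sum>i\<in>I. n)" by (intro sum_mono) force
        then have "(\<Sum>i\<in>I. card (?P i)) \<le> card I * n" by simp
        moreover have "card I * n < m * n" using False n by simp
        ultimately show False using sum by linarith
      qed
      then obtain i where i: "i \<in> I" "n \<le> card (?P i)" by blast
      obtain K where K: "K \<subseteq> Q i" "card K = m"
        using obtain_subset_with_card_n[of m "Q i"] QU[OF i(1)] l by auto
      have "?P i \<subseteq> {v\<in>(\<Union>k\<in>{i<..<2 * m}. U k). \<forall>a\<in>K. r a v}" using K by blast
      moreover have "finite {v\<in>(\<Union>k\<in>{i<..<2 * m}. U k). \<forall>a\<in>K. r a v}" using fU by auto
      ultimately have "n \<le> card {v\<in>(\<Union>k\<in>{i<..<2 * m}. U k). \<forall>a\<in>K. r a v}"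
        using i(2) card_mono le_trans by blast
      moreover have "i < 2 * m" using I i(1) by blast
      moreover have "K \<subseteq> U i" using K(1) QU(1)[OF i(1)] by (rule subset_trans)
      moreover have "rel_clique r K" using QU(3)[OF i(1)] K(1) by (rule rel_clique_mono)
      ultimately show ?thesis using K unfolding spine_with_pages_def by blast
    qed
  qed
qed

text \<open>If \<open>V\<close> is not rich for \<open>r\<close>, some \<open>W\<close> with at
  least half of its vertices has no \<open>r\<close>-clique of size \<open>x\<close>. Any half of
  \<open>W\<close> still has at least \<open>card V / 4 \<ge> N\<close> vertices, so Ramsey's
  theorem finds a clique there, necessarily in the other colour.\<close>

lemma half_rich_exists:
  "\<exists>N. \<forall>(r :: 'a \<Rightarrow> 'a \<Rightarrow> bool) (V :: 'a set). (\<forall>a b. r a b \<longleftrightarrow> r b a) \<longrightarrow> finite V \<longrightarrow> N \<le> card V \<longrightarrow>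
    (\<exists>U\<subseteq>V. card V \<le> 2 * card U \<and> (half_rich r x U \<or> half_rich (\<lambda>a b. \<not> r a b) x U))"
proof -
  obtain N where N: "\<forall>(V::'a set) (E::'a set set). finite V \<and> N \<le> card V \<longrightarrow>
      (\<exists>R \<subseteq> V. card R = x \<and> clique R E \<or> card R = x \<and> indep R E)"
    using ramsey2[of x x, where 'a = 'a] by (elim exE conjE)
  show ?thesis
  proof (intro exI[of _ "4 * N"] allI impI)
    fix r :: "'a \<Rightarrow> 'a \<Rightarrow> bool" and V :: "'a set"
    assume sym: "\<forall>a b. r a b \<longleftrightarrow> r b a" and V: "finite V" "4 * N \<le> card V"
    have rN: "\<exists>Z\<subseteq>W. card Z = x \<and> (rel_clique r Z \<or> rel_clique (\<lambda>a b. \<not> r a b) Z)"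
      if W: "finite W" "N \<le> card W" for W
    proof -
      have *: "{a, b} \<in> {{a, b} | a b. r a b} \<longleftrightarrow> r a b" for a b
        using sym by (auto simp: doubleton_eq_iff)
      have "\<exists>Z \<subseteq> W. card Z = x \<and> clique Z {{a, b} | a b. r a b} \<or> card Z = x \<and> indep Z {{a, b} | a b. r a b}"
        using N W by blast
      then show ?thesis unfolding clique_def indep_def * rel_clique_def by blast
    qed
    show "\<exists>U\<subseteq>V. card V \<le> 2 * card U \<and> (half_rich r x U \<or> half_rich (\<lambda>a b. \<not> r a b) x U)"
    proof (cases "half_rich r x V")
      case True
      then show ?thesis by (intro exI[of _ V]) simp
    next
      case False
      then obtain W where W: "W \<subseteq> V" "card V \<le> 2 * card W" "\<not> (\<exists>Z\<subseteq>W. card Z = x \<and> rel_clique r Z)"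
        using V unfolding half_rich_def by blast
      have fW: "finite W" using W V finite_subset by blast
      have "half_rich (\<lambda>a b. \<not> r a b) x W"
        unfolding half_rich_def
      proof (intro conjI allI impI fW)
        fix X assume X: "X \<subseteq> W" "card W \<le> 2 * card X"
        have "finite X" using X(1) fW by (rule finite_subset)
        moreover have "N \<le> card X" using X W(2) V(2) by linarith
        ultimately have "\<exists>Z\<subseteq>X. card Z = x \<and> (rel_clique r Z \<or> rel_clique (\<lambda>a b. \<not> r a b) Z)"
          by (rule rN)
        then obtain Z where Z: "Z \<subseteq> X" "card Z = x"
          "rel_clique r Z \<or> rel_clique (\<lambda>a b. \<not> r a b) Z"
          by (elim exE conjE)
        moreover have "\<not> rel_clique r Z" using W(3) Z(2) subset_trans[OF Z(1) X(1)] by blast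
        ultimately show "\<exists>Z\<subseteq>X. card Z = x \<and> rel_clique (\<lambda>a b. \<not> r a b) Z" by (intro exI[of _ Z]) simp
      qed
      then show ?thesis using W by blast
    qed
  qed
qed

section \<open>The host graph\<close>

text \<open>Preserving the order in one direction is enough: since the order of \<open>G\<close> is
  total, a failure of the converse would produce a cycle in the order of \<open>F\<close>.\<close>

lemma eo_copy_embedding:
  assumes F: "edge_ordered_graph F" and G: "edge_ordered_graph G"
    and g: "inj_on g (verts G)" "g ` verts G \<subseteq> verts F"
    and edge: "\<And>e. e \<in> edges G \<Longrightarrow> g ` e \<in> edges F"
    and less: "\<And>e e'. (e, e') \<in> edge_less G \<Longrightarrow> (g ` e, g ` e') \<in> edge_less F"
  shows "\<exists>C. eo_copy C G F \<and> edges C = (\<lambda>e. g ` e) ` edges G"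
proof -
  define EC where "EC = (\<lambda>e. g ` e) ` edges G"
  define C where "C = \<lparr>verts = g ` verts G, edges = EC, edge_less = edge_less F \<inter> EC \<times> EC\<rparr>"
  define f where "f = inv_into (verts G) g"
  have ECF: "EC \<subseteq> edges F" using edge by (auto simp: EC_def)
  have Fo: "trans (edge_less F)" "irrefl (edge_less F)" "total_on (edges F) (edge_less F)"
    using F by (auto simp: edge_ordered_graph_def strict_linear_order_on_def)
  have Go: "total_on (edges G) (edge_less G)"
    using G by (auto simp: edge_ordered_graph_def strict_linear_order_on_def)
  have Gv: "e \<subseteq> verts G" if "e \<in> edges G" for e using G that by (auto simp: edge_ordered_graph_def)
  have fg: "f ` g ` e = e" if "e \<in> edges G" for e
    using inv_into_image_cancel[OF g(1) Gv[OF that]] by (simp add: f_def)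
  have "edge_ordered_graph C"
    unfolding edge_ordered_graph_def
  proof (intro conjI ballI)
    show "finite (verts C)" using G by (simp add: C_def edge_ordered_graph_def)
    show "edge_less C \<subseteq> edges C \<times> edges C" by (simp add: C_def)
    show "strict_linear_order_on (edges C) (edge_less C)"
      unfolding strict_linear_order_on_def
    proof (intro conjI)
      show "trans (edge_less C)" using Fo(1) by (auto simp: C_def trans_def)
      show "irrefl (edge_less C)" using Fo(2) by (auto simp: C_def irrefl_def)
      show "total_on (edges C) (edge_less C)" using Fo(3) ECF by (auto simp: C_def total_on_def)
    qed
    fix e assume "e \<in> edges C"
    then obtain d where d: "d \<in> edges G" "e = g ` d" by (auto simp: C_def EC_def)
    then show "e \<subseteq> verts C" using Gv[OF d(1)] by (auto simp: C_def)
    show "card e = 2" using edge[OF d(1)] F d by (simp add: edge_ordered_graph_def)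
  qed
  then have "eo_subgraph C F"
    using F g(2) ECF by (auto simp: eo_subgraph_def C_def)
  moreover have "eo_isomorphic C G"
    unfolding eo_isomorphic_def
  proof (intro exI[of _ f] conjI ballI)
    show "bij_betw f (verts C) (verts G)"
      unfolding f_def C_def using g(1) by (simp add: bij_betw_imageI bij_betw_inv_into inj_on_imp_bij_betw)
    show "edges G = (\<lambda>e. f ` e) ` edges C"
      using fg by (force simp: C_def EC_def image_image)
    fix e e' assume "e \<in> edges C" "e' \<in> edges C"
    then obtain d d' where d: "d \<in> edges G" "e = g ` d" "d' \<in> edges G" "e' = g ` d'"
      by (auto simp: C_def EC_def)
    have "(d, d') \<in> edge_less G" if lt: "(g ` d, g ` d') \<in> edge_less F"
    proof (rule ccontr)
      assume "(d, d') \<notin> edge_less G"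
      moreover have "d \<noteq> d'" using lt Fo(2) by (auto simp: irrefl_def)
      ultimately have "(d', d) \<in> edge_less G" using Go d by (auto simp: total_on_def)
      then have "(g ` d, g ` d) \<in> edge_less F" using less lt Fo(1) by (meson transD)
      then show False using Fo(2) by (simp add: irrefl_def)
    qed
    then show "(e, e') \<in> edge_less C \<longleftrightarrow> (f ` e, f ` e') \<in> edge_less G"
      using d less fg by (auto simp: C_def EC_def)
  qed
  ultimately show ?thesis by (auto simp: eo_copy_def C_def EC_def)
qed

text \<open>Edges inside a block are ordered like spine edges, edges between two blocks like page edges with
  the pages in the later block. Blocks are compared first, so that a clique with one vertex in each
  of several blocks is again ordered like a spine. The last two components of the key determine the
  edge.\<close>

definition host_key :: "nat \<Rightarrow> nat \<Rightarrow> nat set \<Rightarrow> nat \<times> nat \<times> nat \<times> nat" where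
  "host_key s a e = (let u = Min e; v = Max e in
     if a \<le> v then (a, 0, v, u)
     else if u div s = v div s then (u div s, v div s, u, v)
     else (u div s, v div s, v, u))"

text \<open>Requiring the smaller end to be below \<open>a\<close> keeps the last \<open>b\<close>
  vertices independent; a clique on them would cost about \<open>4 ^ m * n\<^sup>2\<close>
  edges.\<close>

definition host_edges :: "nat \<Rightarrow> nat \<Rightarrow> nat set set" where
  "host_edges a b = {{u, v} | u v. u < v \<and> u < a \<and> v < a + b}"

definition host :: "nat \<Rightarrow> nat \<Rightarrow> nat \<Rightarrow> nat eo_graph" where
  "host s a b = \<lparr>verts = {..<a + b}, edges = host_edges a b,
     edge_less = {(e, e'). e \<in> host_edges a b \<and> e' \<in> host_edges a b \<and> host_key s a e < host_key s a e'}\<rparr>"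

lemma host_key_pair:
  "u < v \<Longrightarrow> host_key s a {u, v} =
    (if a \<le> v then (a, 0, v, u)
     else if u div s = v div s then (u div s, v div s, u, v)
     else (u div s, v div s, v, u))"
  by (simp add: host_key_def Let_def)

lemma host_key_inj: "inj_on (host_key s a) (host_edges a b)"
proof (rule inj_onI)
  fix e e' assume e: "e \<in> host_edges a b" "e' \<in> host_edges a b" "host_key s a e = host_key s a e'"
  have "case host_key s a d of (_, _, x, y) \<Rightarrow> d = {x, y}" if d: "d \<in> host_edges a b" for d
  proof -
    obtain u v where "d = {u, v}" "u < v" using d by (auto simp: host_edges_def)
    then show ?thesis by (auto simp: host_key_pair)
  qed
  from this[OF e(1)] this[OF e(2)] e(3) show "e = e'" by (auto split: prod.splits)
qed

lemma edge_ordered_graph_host: "edge_ordered_graph (host s a b)"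
  unfolding edge_ordered_graph_def strict_linear_order_on_def
proof (intro conjI ballI)
  show "trans (edge_less (host s a b))" by (auto simp: host_def trans_def)
  show "irrefl (edge_less (host s a b))" by (auto simp: host_def irrefl_def)
  show "total_on (edges (host s a b)) (edge_less (host s a b))"
    using host_key_inj[of s a b] by (auto simp: host_def total_on_def inj_on_def neq_iff)
  fix e assume "e \<in> edges (host s a b)"
  then obtain u v where "e = {u, v}" "u < v" "u < a" "v < a + b" by (auto simp: host_def host_edges_def)
  then show "e \<subseteq> verts (host s a b)" "card e = 2" by (auto simp: host_def)
qed (auto simp: host_def)

lemma card_edges_host: "card (edges (host s a b)) \<le> a * (a + b)"
proof -
  have "edges (host s a b) \<subseteq> (\<lambda>(u, v). {u, v}) ` ({..<a} \<times> {..<a + b})"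
    by (force simp: host_def host_edges_def)
  then have "card (edges (host s a b)) \<le> card ((\<lambda>(u, v). {u, v}) ` ({..<a} \<times> {..<a + b}))"
    by (intro card_mono) auto
  also have "\<dots> \<le> card ({..<a} \<times> {..<a + b})" by (intro card_image_le) auto
  finally show ?thesis by simp
qed

lemma host_book_copy:
  fixes u w :: "nat \<Rightarrow> nat"
  assumes u: "strict_mono_on {1..m} u" and ua: "\<And>i. i \<in> {1..m} \<Longrightarrow> u i < a"
    and w: "strict_mono_on {1..n} w" and wab: "\<And>i. i \<in> {1..n} \<Longrightarrow> w i < a + b"
    and uw: "\<And>i j. i \<in> {1..m} \<Longrightarrow> j \<in> {1..n} \<Longrightarrow> u i < w j"
    and spine: "(\<forall>i\<in>{1..m}. \<forall>j\<in>{1..m}. u i div s = u j div s) \<or> inj_on (\<lambda>i. u i div s) {1..m}"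
    and page: "(\<forall>j\<in>{1..n}. a \<le> w j) \<or> (\<forall>j\<in>{1..n}. w j < a) \<and>
      (\<forall>i\<in>{1..m}. \<forall>j\<in>{1..m}. u i div s = u j div s) \<and>
      (\<forall>i\<in>{1..m}. \<forall>j\<in>{1..n}. u i div s < w j div s)"
  shows "\<exists>C. eo_copy C (book m n) (host s a b) \<and>
    edges C \<subseteq> {{u i, u j} | i j. 1 \<le> i \<and> i < j \<and> j \<le> m} \<union>
      {{u i, w j} | i j. i \<in> {1..m} \<and> j \<in> {1..n}}"
proof -
  define g where "g = (\<lambda>x. case x of Spine i \<Rightarrow> u i | Page j \<Rightarrow> w j)"
  have gS: "g (Spine i) = u i" and gP: "g (Page j) = w j" for i j by (simp_all add: g_def)
  have ult: "u i < u j" if "1 \<le> i" "i < j" "j \<le> m" for i j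
    using that by (intro strict_mono_onD[OF u]) auto
  have wlt: "w i < w j" if "1 \<le> i" "i < j" "j \<le> n" for i j
    using that by (intro strict_mono_onD[OF w]) auto
  have bmono: "u i div s < u j div s" if ni: "\<not> (\<forall>i\<in>{1..m}. \<forall>j\<in>{1..m}. u i div s = u j div s)"
    and ij: "1 \<le> i" "i < j" "j \<le> m" for i j
  proof -
    have "inj_on (\<lambda>i. u i div s) {1..m}" using spine ni by blast
    then have "u i div s \<noteq> u j div s" using ij inj_onD[of "\<lambda>i. u i div s" "{1..m}" i j] by auto
    moreover have "u i div s \<le> u j div s" using ult[OF ij] by (intro div_le_mono) simp
    ultimately show ?thesis by simp
  qed
  have sedge: "{u i, u j} \<in> host_edges a b" if "1 \<le> i" "i < j" "j \<le> m" for i j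
    using ult[OF that] ua[of i] ua[of j] that unfolding host_edges_def by fastforce
  have pedge: "{w i, u j} \<in> host_edges a b" if "i \<in> {1..n}" "j \<in> {1..m}" for i j
  proof -
    have "{w i, u j} = {u j, w i}" "u j < w i" "u j < a" "w i < a + b"
      using that uw ua wab by auto
    then show ?thesis unfolding host_edges_def by blast
  qed
  have edge: "g ` e \<in> host_edges a b" if "e \<in> edges (book m n)" for e
    using that sedge pedge by (auto simp: book_def spine_edges_def page_edges_def gS gP)
  have key_spine: "host_key s a {u i, u j} =
      (if u i div s = u j div s then (u i div s, u j div s, u i, u j) else (u i div s, u j div s, u j, u i))"
    if "1 \<le> i" "i < j" "j \<le> m" for i j
    using host_key_pair[OF ult[OF that], of s a] ua[of j] that by simp
  have key_page: "host_key s a {w j, u i} = (a, 0, w j, u i)"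
    if "i \<in> {1..m}" "j \<in> {1..n}" "a \<le> w j" for i j
    using host_key_pair[OF uw[OF that(1,2)], of s a] that(3) by (simp add: insert_commute)
  have key_page_block: "host_key s a {w j, u i} = (u i div s, w j div s, w j, u i)"
    if "i \<in> {1..m}" "j \<in> {1..n}" "w j < a" "u i div s < w j div s" for i j
    using host_key_pair[OF uw[OF that(1,2)], of s a] that(3,4) by (simp add: insert_commute)
  \<comment> \<open>Within one block the vertices decide, after a tie of the first two components;
    for a transversal spine the block indices already decide.\<close>
  have ss: "host_key s a {u i, u j} < host_key s a {u p, u q}"
    if *: "1 \<le> i" "i < j" "j \<le> m" "1 \<le> p" "p < q" "q \<le> m" and lt: "i < p \<or> i = p \<and> j < q"
    for i j p q
  proof (cases "\<forall>i\<in>{1..m}. \<forall>j\<in>{1..m}. u i div s = u j div s")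
    case True
    then have "u i div s = u p div s" "u j div s = u p div s" "u q div s = u p div s"
      using * by simp_all
    moreover have "u i < u p \<or> u i = u p \<and> u j < u q" using lt ult[of i p] ult[of j q] * by auto
    ultimately show ?thesis by (auto simp: key_spine[OF *(1-3)] key_spine[OF *(4-6)])
  next
    case False
    have "u i div s < u p div s \<or> u i div s = u p div s \<and> u j div s < u q div s"
      using lt bmono[OF False, of i p] bmono[OF False, of j q] * by auto
    moreover have "u i div s < u j div s" "u p div s < u q div s"
      using bmono[OF False] * by simp_all
    ultimately show ?thesis by (auto simp: key_spine[OF *(1-3)] key_spine[OF *(4-6)])
  qed
  \<comment> \<open>For a page beyond the blocks, the first component \<open>a\<close> exceeds every
    block index of the spine. For a page in a block, the first components agree and the later block
    of the page decides.\<close>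
  have sp: "host_key s a {u i, u j} < host_key s a {w p, u q}"
    if ij: "1 \<le> i" "i < j" "j \<le> m" and pq: "q \<in> {1..m}" "p \<in> {1..n}" for i j p q
  proof (cases "a \<le> w p")
    case True
    have "u i div s \<le> u i" by (rule div_le_dividend)
    also have "u i < a" using ua ij by simp
    finally show ?thesis by (simp add: key_spine[OF ij] key_page[OF pq True])
  next
    case False
    then have *: "\<And>i j. i \<in> {1..m} \<Longrightarrow> j \<in> {1..m} \<Longrightarrow> u i div s = u j div s"
      "\<And>i j. i \<in> {1..m} \<Longrightarrow> j \<in> {1..n} \<Longrightarrow> u i div s < w j div s"
      using page pq by blast+
    have "u i div s = u q div s" "u j div s = u q div s"
      using *(1)[OF _ pq(1)] ij by simp_all
    moreover have "u q div s < w p div s" using *(2) pq by simp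
    ultimately show ?thesis
      using False by (simp add: key_spine[OF ij] key_page_block[OF pq])
  qed
  have pp: "host_key s a {w i, u j} < host_key s a {w p, u q}"
    if ji: "j \<in> {1..m}" "i \<in> {1..n}" and qp: "q \<in> {1..m}" "p \<in> {1..n}"
      and lt: "i < p \<or> i = p \<and> j < q" for i j p q
  proof -
    have wu: "w i < w p \<or> w i = w p \<and> u j < u q"
      using lt wlt[of i p] ult[of j q] ji qp by auto
    from page show ?thesis
    proof (elim disjE conjE)
      assume "\<forall>j\<in>{1..n}. a \<le> w j"
      then have "a \<le> w i" "a \<le> w p" using ji qp by blast+
      then show ?thesis using wu by (auto simp: key_page[OF ji] key_page[OF qp])
    next
      assume *: "\<forall>j\<in>{1..n}. w j < a" "\<forall>i\<in>{1..m}. \<forall>j\<in>{1..m}. u i div s = u j div s"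
        "\<forall>i\<in>{1..m}. \<forall>j\<in>{1..n}. u i div s < w j div s"
      have "u j div s = u q div s" using *(2) ji(1) qp(1) by blast
      moreover have "w i div s \<le> w p div s" using wu by (intro div_le_mono) auto
      moreover have "w i < a" "w p < a" "u j div s < w i div s" "u q div s < w p div s"
        using *(1,3) ji qp by blast+
      ultimately show ?thesis
        using wu by (auto simp: key_page_block[OF ji] key_page_block[OF qp])
    qed
  qed
  have less: "(g ` e, g ` e') \<in> edge_less (host s a b)" if lt: "(e, e') \<in> edge_less (book m n)" for e e'
  proof -
    have sub: "edge_less (book m n) \<subseteq> edges (book m n) \<times> edges (book m n)"
      using edge_ordered_graph_book by (simp add: edge_ordered_graph_def)
    have "host_key s a (g ` e) < host_key s a (g ` e')"
      using lt unfolding book_def spine_edges_def page_edges_def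
      by (auto simp: gS gP intro!: ss sp pp)
    then show ?thesis using edge lt sub by (auto simp: host_def)
  qed
  have "inj_on g (verts (book m n))"
  proof -
    have "g \<circ> Spine = u" "g \<circ> Page = w" by (auto simp: gS gP)
    then have "inj_on g (Spine ` {1..m})" "inj_on g (Page ` {1..n})"
      using strict_mono_on_imp_inj_on[OF u] strict_mono_on_imp_inj_on[OF w]
      by (metis inj_on_imageI)+
    moreover have "g ` (Spine ` {1..m} - Page ` {1..n}) \<inter> g ` (Page ` {1..n} - Spine ` {1..m}) = {}"
    proof -
      have "g x \<noteq> g y" if "x \<in> Spine ` {1..m}" "y \<in> Page ` {1..n}" for x y
        using that uw by (metis gP gS imageE less_irrefl)
      then show ?thesis by blast
    qed
    ultimately show ?thesis by (simp add: book_def inj_on_Un)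
  qed
  moreover have "g ` verts (book m n) \<subseteq> verts (host s a b)"
    using ua wab by (fastforce simp: book_def host_def gS gP)
  ultimately obtain C where C: "eo_copy C (book m n) (host s a b)"
    "edges C = (\<lambda>e. g ` e) ` edges (book m n)"
    using eo_copy_embedding[OF edge_ordered_graph_host edge_ordered_graph_book, of g m n s a b]
      edge less by (auto simp: host_def)
  have "edges C \<subseteq> {{u i, u j} | i j. 1 \<le> i \<and> i < j \<and> j \<le> m} \<union>
      {{u i, w j} | i j. i \<in> {1..m} \<and> j \<in> {1..n}}"
    unfolding C(2) by (fastforce simp: book_def spine_edges_def page_edges_def gS gP insert_commute)
  then show ?thesis using C(1) by blast
qed

lemma enumerate_upward:
  fixes S :: "nat set"
  assumes "finite S" "k \<le> card S"
  obtains f where "strict_mono_on {1..k} f" "\<And>i. i \<in> {1..k} \<Longrightarrow> f i \<in> S"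
proof
  \<comment> \<open>\<open>enumerate\<close> counts from 0, the book from 1.\<close>
  show "strict_mono_on {1..k} (\<lambda>i. enumerate S (i - 1))"
    using assms by (intro strict_mono_onI finite_enumerate_mono) auto
  show "enumerate S (i - 1) \<in> S" if "i \<in> {1..k}" for i
    using assms that by (intro finite_enumerate_in_set) auto
qed

lemma host_book_copy_sets:
  assumes K: "K \<subseteq> {..<a}" "m \<le> card K" and P: "P \<subseteq> {..<a + b}" "n \<le> card P"
    and page: "(\<forall>x\<in>K. \<forall>y\<in>K. x div s = y div s) \<and>
        ((\<forall>v\<in>P. a \<le> v) \<or> (\<forall>v\<in>P. v < a \<and> (\<forall>x\<in>K. x div s < v div s))) \<or>
      inj_on (\<lambda>x. x div s) K \<and> (\<forall>v\<in>P. a \<le> v)"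
    and KK: "\<And>x y. x \<in> K \<Longrightarrow> y \<in> K \<Longrightarrow> x \<noteq> y \<Longrightarrow> {x, y} \<in> E"
    and KP: "\<And>x v. x \<in> K \<Longrightarrow> v \<in> P \<Longrightarrow> {x, v} \<in> E"
  shows "\<exists>C. eo_copy C (book m n) (host s a b) \<and> edges C \<subseteq> E"
proof -
  have fin: "finite K" "finite P" using K P by (auto intro: finite_subset)
  obtain u where u: "strict_mono_on {1..m} u" "\<And>i. i \<in> {1..m} \<Longrightarrow> u i \<in> K"
    using enumerate_upward[OF fin(1) K(2)] by blast
  obtain w where w: "strict_mono_on {1..n} w" "\<And>i. i \<in> {1..n} \<Longrightarrow> w i \<in> P"
    using enumerate_upward[OF fin(2) P(2)] by blast
  have lt: "x < v" if "x \<in> K" "v \<in> P" for x v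
  proof -
    have "a \<le> v \<or> x div s < v div s" using page that by blast
    moreover have "x < a" using K that by auto
    ultimately show ?thesis using div_le_mono[of v x s] by (auto simp: not_less[symmetric])
  qed
  have injw: "inj_on u {1..m}" using u(1) by (rule strict_mono_on_imp_inj_on)
  have "\<exists>C. eo_copy C (book m n) (host s a b) \<and>
    edges C \<subseteq> {{u i, u j} | i j. 1 \<le> i \<and> i < j \<and> j \<le> m} \<union>
      {{u i, w j} | i j. i \<in> {1..m} \<and> j \<in> {1..n}}"
  proof (rule host_book_copy)
    show "(\<forall>i\<in>{1..m}. \<forall>j\<in>{1..m}. u i div s = u j div s) \<or> inj_on (\<lambda>i. u i div s) {1..m}"
      using page
    proof (elim disjE conjE)
      assume "inj_on (\<lambda>x. x div s) K"
      then have "inj_on ((\<lambda>x. x div s) \<circ> u) {1..m}"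
        using u(2) injw by (intro comp_inj_on) (auto intro: inj_on_subset)
      then show ?thesis by (simp add: o_def)
    qed (use u(2) in blast)+
    show "(\<forall>j\<in>{1..n}. a \<le> w j) \<or> (\<forall>j\<in>{1..n}. w j < a) \<and>
      (\<forall>i\<in>{1..m}. \<forall>j\<in>{1..m}. u i div s = u j div s) \<and>
      (\<forall>i\<in>{1..m}. \<forall>j\<in>{1..n}. u i div s < w j div s)"
      using page u(2) w(2) by blast
  qed (use u w K P lt in auto)
  then obtain C where C: "eo_copy C (book m n) (host s a b)" "edges C \<subseteq>
      {{u i, u j} | i j. 1 \<le> i \<and> i < j \<and> j \<le> m} \<union> {{u i, w j} | i j. i \<in> {1..m} \<and> j \<in> {1..n}}"
    by blast
  moreover have "{u i, u j} \<in> E" if "1 \<le> i" "i < j" "j \<le> m" for i j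
  proof -
    have "u i < u j" using that by (intro strict_mono_onD[OF u(1)]) auto
    then show ?thesis using KK[of "u i" "u j"] u(2) that by auto
  qed
  moreover have "{u i, w j} \<in> E" if "i \<in> {1..m}" "j \<in> {1..n}" for i j
    using KP u(2) w(2) that by blast
  ultimately show ?thesis by blast
qed

section \<open>Upper bound\<close>

text \<open>\<open>T\<close> is instantiated with the red edges and with their complement; taking
  \<open>- T\<close> among all vertex sets makes the colours symmetric, and edges of a copy are host
  edges anyway. Assumption \<open>x\<close> is the property that \<open>monochromatic_spine\<close>
  guarantees for some clique size.\<close>

lemma host_contains_book:
  fixes T :: "nat set set" and U :: "nat \<Rightarrow> nat set"
  assumes m: "2 \<le> m" and n: "1 \<le> n" and s: "0 < s" and b: "2 ^ (m + 4) * n \<le> b"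
    and I: "I \<subseteq> {..<4 * m}" "2 * m \<le> card I"
    and U: "\<And>i. i \<in> I \<Longrightarrow> U i \<subseteq> {i * s..<(i + 1) * s}" "\<And>i. i \<in> I \<Longrightarrow> 4 * n \<le> card (U i)"
    and rich: "\<And>i. i \<in> I \<Longrightarrow> half_rich (\<lambda>u v. {u, v} \<in> T) x (U i)"
    and x: "\<forall>(r :: nat \<Rightarrow> nat \<Rightarrow> bool) U B n. (\<forall>a b. r a b \<longleftrightarrow> r b a) \<longrightarrow>
      (\<forall>i<2 * m. half_rich r x (U i) \<and> 4 * n \<le> card (U i)) \<longrightarrow>
      (\<forall>i<2 * m. \<forall>j<2 * m. i \<noteq> j \<longrightarrow> U i \<inter> U j = {}) \<longrightarrow>
      finite B \<longrightarrow> 2 ^ (m + 4) * n \<le> card B \<longrightarrow> 1 \<le> n \<longrightarrow>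
      spine_with_pages m n r U B"
  shows "\<exists>C. eo_copy C (book m n) (host s (4 * m * s) b) \<and> (edges C \<subseteq> T \<or> edges C \<subseteq> - T)"
proof -
  let ?a = "4 * m * s"
  let ?r = "\<lambda>u v. {u, v} \<in> T"
  define B where "B = {?a..<?a + b}"
  \<comment> \<open>Listing the rich blocks in increasing order ensures that a later position means
    a later block of the host, as pages inside blocks require.\<close>
  obtain \<sigma> where \<sigma>: "strict_mono_on {1..2 * m} \<sigma>" "\<And>i. i \<in> {1..2 * m} \<Longrightarrow> \<sigma> i \<in> I"
    using enumerate_upward[of I "2 * m"] I finite_subset by blast
  define W where "W = (\<lambda>i. U (\<sigma> (Suc i)))"
  have \<sigma>I: "\<sigma> (Suc i) \<in> I" if "i < 2 * m" for i using \<sigma>(2) that by simp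
  have \<sigma>lt: "\<sigma> (Suc i) < \<sigma> (Suc j)" if "i < j" "j < 2 * m" for i j
    using that by (intro strict_mono_onD[OF \<sigma>(1)]) auto
  have block: "v div s = \<sigma> (Suc i)" "v < ?a" if "i < 2 * m" "v \<in> W i" for i v
  proof -
    have *: "v \<in> {\<sigma> (Suc i) * s..<(\<sigma> (Suc i) + 1) * s}"
      using U(1)[OF \<sigma>I[OF that(1)]] that(2) by (auto simp: W_def)
    show "v div s = \<sigma> (Suc i)"
      by (rule div_nat_eqI) (use * in \<open>auto simp: mult.commute\<close>)
    have "(\<sigma> (Suc i) + 1) * s \<le> ?a"
      using \<sigma>I[OF that(1)] I(1) by (intro mult_right_mono) auto
    then show "v < ?a" using * by simp
  qed
  have disj: "W i \<inter> W j = {}" if "i < 2 * m" "j < 2 * m" "i \<noteq> j" for i j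
  proof -
    have "\<sigma> (Suc i) \<noteq> \<sigma> (Suc j)" using \<sigma>lt[of i j] \<sigma>lt[of j i] that by (cases i j rule: linorder_cases) auto
    then show ?thesis using block(1)[OF that(1)] block(1)[OF that(2)] by force
  qed
  have "spine_with_pages m n ?r W B"
    by (rule x[rule_format, of ?r])
      (use disj rich U(2) \<sigma>I b n in \<open>auto simp: W_def B_def insert_commute\<close>)
  then consider (later) j K where "j < 2 * m" "K \<subseteq> W j" "card K = m" "rel_clique ?r K"
      "n \<le> card {v\<in>(\<Union>k\<in>{j<..<2 * m}. W k). \<forall>a\<in>K. ?r a v}"
    | (far) j K where "j < 2 * m" "K \<subseteq> W j" "card K = m" "rel_clique ?r K"
      "n \<le> card {v\<in>B. \<forall>a\<in>K. ?r a v}"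
    | (across) I' f where "I' \<subseteq> {..<2 * m}" "card I' = m" "\<forall>i\<in>I'. f i \<in> W i"
      "\<forall>i\<in>I'. \<forall>j\<in>I'. i \<noteq> j \<longrightarrow> \<not> ?r (f i) (f j)" "n \<le> card {v\<in>B. \<forall>i\<in>I'. \<not> ?r (f i) v}"
    unfolding spine_with_pages_def by (elim disjE exE conjE) 
  then show ?thesis
  proof cases
    case later
    define P where "P = {v\<in>(\<Union>k\<in>{j<..<2 * m}. W k). \<forall>a\<in>K. ?r a v}"
    have KW: "u div s = \<sigma> (Suc j)" "u < ?a" if "u \<in> K" for u
      using block[OF later(1), of u] later(2) that by blast+
    have PW: "\<sigma> (Suc j) < v div s" "v < ?a" if "v \<in> P" for v
    proof -
      from that have "\<exists>k\<in>{j<..<2 * m}. v \<in> W k" by (simp add: P_def)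
      then obtain k where k: "j < k" "k < 2 * m" "v \<in> W k" by auto
      then show "\<sigma> (Suc j) < v div s" "v < ?a" using block[OF k(2,3)] \<sigma>lt[OF k(1,2)] by simp_all
    qed
    have "\<exists>C. eo_copy C (book m n) (host s ?a b) \<and> edges C \<subseteq> T"
    proof (rule host_book_copy_sets[of K _ _ P])
      show "P \<subseteq> {..<?a + b}" using PW(2) by fastforce
      show "n \<le> card P" using later(5) by (simp add: P_def)
      show "(\<forall>x\<in>K. \<forall>y\<in>K. x div s = y div s) \<and>
          ((\<forall>v\<in>P. ?a \<le> v) \<or> (\<forall>v\<in>P. v < ?a \<and> (\<forall>x\<in>K. x div s < v div s))) \<or>
        inj_on (\<lambda>x. x div s) K \<and> (\<forall>v\<in>P. ?a \<le> v)"
        using KW(1) PW by simp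
      show "{x, y} \<in> T" if "x \<in> K" "y \<in> K" "x \<noteq> y" for x y
        using later(4) that by (simp add: rel_clique_def)
      show "{x, v} \<in> T" if "x \<in> K" "v \<in> P" for x v using that by (simp add: P_def)
    qed (use KW later in auto)
    then show ?thesis by blast
  next
    case far
    define P where "P = {v\<in>B. \<forall>a\<in>K. ?r a v}"
    have KW: "u div s = \<sigma> (Suc j)" "u < ?a" if "u \<in> K" for u
      using block[OF far(1), of u] far(2) that by blast+
    have "\<exists>C. eo_copy C (book m n) (host s ?a b) \<and> edges C \<subseteq> T"
    proof (rule host_book_copy_sets[of K _ _ P])
      show "P \<subseteq> {..<?a + b}" by (auto simp: P_def B_def)
      show "n \<le> card P" using far(5) by (simp add: P_def)
      show "(\<forall>x\<in>K. \<forall>y\<in>K. x div s = y div s) \<and>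
          ((\<forall>v\<in>P. ?a \<le> v) \<or> (\<forall>v\<in>P. v < ?a \<and> (\<forall>x\<in>K. x div s < v div s))) \<or>
        inj_on (\<lambda>x. x div s) K \<and> (\<forall>v\<in>P. ?a \<le> v)"
        using KW(1) by (simp add: P_def B_def)
      show "{x, y} \<in> T" if "x \<in> K" "y \<in> K" "x \<noteq> y" for x y
        using far(4) that by (simp add: rel_clique_def)
      show "{x, v} \<in> T" if "x \<in> K" "v \<in> P" for x v using that by (simp add: P_def)
    qed (use KW far in auto)
    then show ?thesis by blast
  next
    case across
    define P where "P = {v\<in>B. \<forall>i\<in>I'. \<not> ?r (f i) v}"
    have fW: "f i div s = \<sigma> (Suc i)" "f i < ?a" if "i \<in> I'" for i
      using block[of i "f i"] across(1,3) that by blast+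
    have inj: "inj_on (\<lambda>i. f i div s) I'"
    proof (rule inj_onI)
      fix i j assume ij: "i \<in> I'" "j \<in> I'" "f i div s = f j div s"
      then have "\<sigma> (Suc i) = \<sigma> (Suc j)" using fW by simp
      then show "i = j"
        using \<sigma>lt[of i j] \<sigma>lt[of j i] ij across(1) by (cases i j rule: linorder_cases) auto
    qed
    have injf: "inj_on f I'" using inj unfolding inj_on_def by metis
    have "\<exists>C. eo_copy C (book m n) (host s ?a b) \<and> edges C \<subseteq> - T"
    proof (rule host_book_copy_sets[of "f ` I'" _ _ P])
      show "f ` I' \<subseteq> {..<?a}" using fW(2) by auto
      show "m \<le> card (f ` I')" using across(2) injf by (simp add: card_image)
      show "P \<subseteq> {..<?a + b}" by (auto simp: P_def B_def)
      show "n \<le> card P" using across(5) by (simp add: P_def)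
      have "inj_on (\<lambda>x. x div s) (f ` I')" using inj by (intro inj_on_imageI) (simp add: o_def)
      then show "(\<forall>x\<in>f ` I'. \<forall>y\<in>f ` I'. x div s = y div s) \<and>
          ((\<forall>v\<in>P. ?a \<le> v) \<or> (\<forall>v\<in>P. v < ?a \<and> (\<forall>x\<in>f ` I'. x div s < v div s))) \<or>
        inj_on (\<lambda>x. x div s) (f ` I') \<and> (\<forall>v\<in>P. ?a \<le> v)"
        by (simp add: P_def B_def)
      show "{x, y} \<in> - T" if "x \<in> f ` I'" "y \<in> f ` I'" "x \<noteq> y" for x y
        using across(4) that by auto
      show "{x, v} \<in> - T" if "x \<in> f ` I'" "v \<in> P" for x v using that by (auto simp: P_def)
    qed
    then show ?thesis by blast
  qed
qed

lemma host_arrows_book: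
  assumes m: "2 \<le> m"
  shows "\<exists>n0. \<forall>n\<ge>n0. 1 \<le> n \<longrightarrow>
    eo_arrows (host (8 * n) (4 * m * (8 * n)) (2 ^ (m + 4) * n)) (book m n) (book m n)"
proof -
  note monochromatic_spine[OF m, where 'a = nat]
  then obtain x where x: "\<forall>(r :: nat \<Rightarrow> nat \<Rightarrow> bool) U B n. (\<forall>a b. r a b \<longleftrightarrow> r b a) \<longrightarrow>
      (\<forall>i<2 * m. half_rich r x (U i) \<and> 4 * n \<le> card (U i)) \<longrightarrow>
      (\<forall>i<2 * m. \<forall>j<2 * m. i \<noteq> j \<longrightarrow> U i \<inter> U j = {}) \<longrightarrow>
      finite B \<longrightarrow> 2 ^ (m + 4) * n \<le> card B \<longrightarrow> 1 \<le> n \<longrightarrow>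
      spine_with_pages m n r U B"
    by (elim exE)
  note half_rich_exists[where 'a = nat, of x]
  then obtain N where N: "\<forall>(r :: nat \<Rightarrow> nat \<Rightarrow> bool) V. (\<forall>a b. r a b \<longleftrightarrow> r b a) \<longrightarrow> finite V \<longrightarrow> N \<le> card V \<longrightarrow>
    (\<exists>U\<subseteq>V. card V \<le> 2 * card U \<and> (half_rich r x U \<or> half_rich (\<lambda>a b. \<not> r a b) x U))"
    by (elim exE)
  show ?thesis
  proof (intro exI[of _ N] allI impI)
    fix n assume n: "N \<le> n" "1 \<le> n"
    \<comment> \<open>With this block size, the rich half of each block has the \<open>4 * n\<close>
      vertices that \<open>monochromatic_spine\<close> asks for.\<close>
    define s where "s = 8 * n"
    let ?F = "host s (4 * m * s) (2 ^ (m + 4) * n)"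
    have "eo_arrows ?F (book m n) (book m n)"
      unfolding eo_arrows_def
    proof (intro allI impI)
      fix R assume "R \<subseteq> edges ?F"
      have blocks: "\<exists>U\<subseteq>{i * s..<(i + 1) * s}. 4 * n \<le> card U \<and>
          (half_rich (\<lambda>u v. {u, v} \<in> R) x U \<or> half_rich (\<lambda>u v. {u, v} \<in> - R) x U)" for i
      proof -
        have c: "card {i * s..<(i + 1) * s} = 8 * n" by (simp add: s_def)
        have "\<exists>U\<subseteq>{i * s..<(i + 1) * s}. card {i * s..<(i + 1) * s} \<le> 2 * card U \<and>
          (half_rich (\<lambda>u v. {u, v} \<in> R) x U \<or> half_rich (\<lambda>u v. \<not> {u, v} \<in> R) x U)"
          by (rule N[rule_format]) (use c n in \<open>auto simp: insert_commute\<close>)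
        then obtain U where "U \<subseteq> {i * s..<(i + 1) * s}" "card {i * s..<(i + 1) * s} \<le> 2 * card U"
          "half_rich (\<lambda>u v. {u, v} \<in> R) x U \<or> half_rich (\<lambda>u v. \<not> {u, v} \<in> R) x U"
          by (elim exE conjE)
        then show ?thesis unfolding c by (intro exI[of _ U]) simp
      qed
      then obtain U where U: "\<And>i. U i \<subseteq> {i * s..<(i + 1) * s}" "\<And>i. 4 * n \<le> card (U i)"
        "\<And>i. half_rich (\<lambda>u v. {u, v} \<in> R) x (U i) \<or> half_rich (\<lambda>u v. {u, v} \<in> - R) x (U i)"
        by metis
      define I where "I = {i\<in>{..<4 * m}. half_rich (\<lambda>u v. {u, v} \<in> R) x (U i)}"
      have "\<exists>C. eo_copy C (book m n) ?F \<and> (edges C \<subseteq> R \<or> edges C \<subseteq> - R)"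
      proof (cases "2 * m \<le> card I")
        case True
        show ?thesis
          by (rule host_contains_book[OF m n(2) _ _ _ True U(1,2) _ x])
            (use n in \<open>auto simp: I_def s_def\<close>)
      next
        case False
        have "card ({..<4 * m} - I) = 4 * m - card I"
          by (subst card_Diff_subset) (auto simp: I_def)
        then have big: "2 * m \<le> card ({..<4 * m} - I)" using False by simp
        \<comment> \<open>The blocks outside \<open>I\<close> are rich in blue cliques, so the
          colours change roles.\<close>
        have "\<exists>C. eo_copy C (book m n) ?F \<and> (edges C \<subseteq> - R \<or> edges C \<subseteq> - (- R))"
          by (rule host_contains_book[OF m n(2) _ _ _ big U(1,2) _ x])
            (use n U(3) in \<open>auto simp: I_def s_def\<close>)
        then show ?thesis by auto
      qed
      then show "(\<exists>C. eo_copy C (book m n) ?F \<and> edges C \<subseteq> R) \<or>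
          (\<exists>C. eo_copy C (book m n) ?F \<and> edges C \<subseteq> edges ?F - R)"
        by (auto simp: eo_copy_def eo_subgraph_def)
    qed
    then show "eo_arrows (host (8 * n) (4 * m * (8 * n)) (2 ^ (m + 4) * n)) (book m n) (book m n)"
      by (simp add: s_def)
  qed
qed

lemma size_eo_ramsey_book_upper:
  assumes m: "2 \<le> m"
  shows "\<forall>\<^sub>F n in sequentially.
    ereal_of_enat (size_eo_ramsey (book m n)) \<le> ereal (1536 * (real m * 2 ^ m * (real n)\<^sup>2))"
proof -
  obtain n0 where n0: "\<forall>n\<ge>n0. 1 \<le> n \<longrightarrow>
    eo_arrows (host (8 * n) (4 * m * (8 * n)) (2 ^ (m + 4) * n)) (book m n) (book m n)"
    using host_arrows_book[OF m] by blast
  show ?thesis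
    using eventually_ge_at_top[of "max n0 1"]
  proof eventually_elim
    case (elim n)
    let ?F = "host (8 * n) (4 * m * (8 * n)) (2 ^ (m + 4) * n)"
    have "eo_arrows ?F (book m n) (book m n)" using n0 elim by simp
    then have "size_eo_ramsey (book m n) \<le> enat (card (edges ?F))"
      unfolding size_eo_ramsey_def size_eo_ramsey2_def
      using edge_ordered_graph_host by (intro Inf_lower) blast
    also have "\<dots> \<le> enat (1536 * (m * 2 ^ m * n\<^sup>2))"
    proof -
      have "m \<le> 2 ^ m" by (rule less_imp_le) (rule less_exp)
      then have "m * m \<le> m * 2 ^ m" by simp
      have "card (edges ?F) \<le> 4 * m * (8 * n) * (4 * m * (8 * n) + 2 ^ (m + 4) * n)"
        by (rule card_edges_host)
      \<comment> \<open>The blocks have \<open>32 * m * n\<close> vertices in total;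
        \<open>32 * 32\<close> counts pairs among them and \<open>32 * 16\<close> pairs with a
        further vertex. Together they give the constant 1536.\<close>
      also have "\<dots> = 1024 * (m * m) * n\<^sup>2 + 512 * (m * 2 ^ m) * n\<^sup>2"
        by (simp add: power_add power2_eq_square algebra_simps)
      also have "\<dots> \<le> 1024 * (m * 2 ^ m) * n\<^sup>2 + 512 * (m * 2 ^ m) * n\<^sup>2"
        using \<open>m * m \<le> m * 2 ^ m\<close> by (intro add_mono mult_right_mono mult_left_mono) auto
      also have "\<dots> = 1536 * (m * 2 ^ m * n\<^sup>2)" by (simp add: algebra_simps)
      finally show ?thesis by (simp only: enat_ord_simps)
    qed
    finally have "ereal_of_enat (size_eo_ramsey (book m n))
        \<le> ereal_of_enat (enat (1536 * (m * 2 ^ m * n\<^sup>2)))"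
      by (simp only: ereal_of_enat_le_iff)
    then show ?case by simp
  qed
qed

theorem corollary2p6:
  shows "\<exists>c C :: real. 0 < c \<and> 0 < C \<and>
    (\<forall>m :: nat. 2 \<le> m \<longrightarrow>
      (\<forall>\<^sub>F n in sequentially.
         ereal (c * (real m * 2 ^ m * (real n)\<^sup>2)) \<le> ereal_of_enat (size_eo_ramsey (book m n)) \<and>
         ereal_of_enat (size_eo_ramsey (book m n)) \<le> ereal (C * (real m * 2 ^ m * (real n)\<^sup>2))))"
proof (rule exI[of _ "1 / 4096"], rule exI[of _ 1536], intro conjI allI impI)
  fix m :: nat assume "2 \<le> m"
  then show "\<forall>\<^sub>F n in sequentially.
      ereal (1 / 4096 * (real m * 2 ^ m * (real n)\<^sup>2)) \<le> ereal_of_enat (size_eo_ramsey (book m n)) \<and>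
      ereal_of_enat (size_eo_ramsey (book m n)) \<le> ereal (1536 * (real m * 2 ^ m * (real n)\<^sup>2))"
    by (intro eventually_conj size_eo_ramsey_book_lower size_eo_ramsey_book_upper)
qed simp_all

end
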